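(* Let $m\ge1$, let $x,y,t,q$ be variables and $X=(x_0,x_1,\dots)$, $Y=(y_0,y_1,\dots)$ commutative alphabets. Define $$\Phi_m(t;x,y,X,Y,q)=\sum_{I} t^{\mathrm{size}(I)}\,x^{\mathrm{mcontacts}(I)}\,y^{\mathrm{mrises}(I)}\,\mathrm{mContactMon}(I,X)\,\mathrm{mRiseMon}(I,Y)\,q^{\mathrm{dist}(I)},$$ summed over all intervals $I$ of the $m$-Tamari lattices $\mathrm{Tam}_n^m$ (all $n$). Then $\Phi_m(t;x,y,X,Y,q)=\Phi_m(t;y,x,Y,X,q)$ (exchange $x\leftrightarrow y$ and $x_i\leftrightarrow y_i$).
   Context: An $m$-ballot path of size $n$ is a lattice path from $(0,0)$ to $(nm,n)$ with unit vertical steps $(0,1)$ and horizontal steps $(1,0)$ staying weakly above the line $y=x/m$. A primitive path is one touching $y=x/m$ only at its endpoints. The $m$-Tamari lattice $\mathrm{Tam}_n^m$ is the order on $m$-ballot paths of size $n$ generated by rotations: take a horizontal step $d$ followed by a vertical step, and the (translated) primitive path $p$ starting right after $d$ (i.e. the subpath from the end of $d$ up to its first return to the line of slope $1/m$ through the end of $d$); the rotation exchanges $d$ and $p$ (so $\dots d\,p\dots\mapsto\dots p\,d\dots$), producing a larger path. An interval is $I=[B_1,B_2]$ with $B_1\le B_2$; $\mathrm{size}(I)=n$; $\mathrm{dist}(I)$ is the maximal length (number of cover relations) of a chain from $B_1$ to $B_2$ in $\mathrm{Tam}_n^m$. $m$-statistics of an $m$-ballot path $B$ of size $n$: $\mathrm{mcontacts}(B)$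 is the number of points of $B$ on $y=x/m$ other than the last point; $\mathrm{mrises}(B)$ is the number of initial consecutive vertical steps. For the $i$-th vertical step $u_i$ with starting point $(a,b)$ and $1\le j\le m$, let $\ell_{i,j}$ be the line of slope $1/m$ through $(a,b+j/m)$ and $d_{i,j}$ the maximal portion of $B$ starting at $(a,b+1)$ that stays weakly above $\ell_{i,j}$; $c_{i,j}(B)$ is the number of contacts between $d_{i,j}$ and $\ell_{i,j}$ other than the final one. For the $i$-th horizontal step, $r_i(B)$ is the number of consecutive vertical steps right after it. The $m$-contact vector is $(\mathrm{mcontacts}(B),c_{1,1},\dots,c_{1,m},\dots,c_{n,1},\dots,c_{n,m-1})$ (length $nm$; $c_{n,m}$ omitted) and the $m$-rise vector is $(\mathrm{mrises}(B),r_1,\dots,r_{nm-1})$. $\mathrm{mContactMon}(B,X)=\prod x_{v}$ over the entries $v$ of the $m$-contact vector, $\mathrm{mRiseMon}(B,Y)=\prod y_w$ over the entries $w$ of the $m$-rise vector. For an interval $I=[B_1,B_2]$, $\mathrm{mcontacts}$ and $\mathrm{mContactMon}$ are those of $B_1$, and $\mathrm{mrises}$ and $\mathrm{mRiseMon}$ those of $B_2$. *)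

theory Defs
  imports
    "HOL-Library.Poly_Mapping"
    "HOL-Computational_Algebra.Formal_Power_Series"
begin

datatype step = Vert | Hor

type_synonym path = "step list"

text \<open>A path starts at the origin; its \<^term>\<open>k\<close>-th point is the one reached after
  \<^term>\<open>k\<close> steps, \<open>0 \<le> k \<le> length w\<close>.\<close>

definition xpos :: "path \<Rightarrow> nat \<Rightarrow> nat" where
  "xpos w k = count_list (take k w) Hor"

definition ypos :: "path \<Rightarrow> nat \<Rightarrow> nat" where
  "ypos w k = count_list (take k w) Vert"

text \<open>For \<open>m \<ge> 1\<close>, the level \<open>m y - x\<close> of a point \<open>(x, y)\<close> is constant on each line of slope
  \<open>1/m\<close> and increases with \<open>y\<close>. Hence a point is on (weakly above) the line of slope \<open>1/m\<close>
  through \<open>(x', y')\<close> iff its level equals (is at least) \<open>m y' - x'\<close>; the line \<open>y = x/m\<close> is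
  level \<open>0\<close>, and the line through \<open>(a, b + j/m)\<close> is the level of \<open>(a, b)\<close> plus \<open>j\<close>.\<close>

definition level :: "nat \<Rightarrow> path \<Rightarrow> nat \<Rightarrow> int" where
  "level m w k = int m * int (ypos w k) - int (xpos w k)"

definition ballot_path :: "nat \<Rightarrow> nat \<Rightarrow> path \<Rightarrow> bool" where
  "ballot_path m n w \<longleftrightarrow>
     count_list w Hor = n * m \<and> count_list w Vert = n \<and> (\<forall>k\<le>length w. 0 \<le> level m w k)"

definition primitive_path :: "nat \<Rightarrow> path \<Rightarrow> bool" where
  "primitive_path m p \<longleftrightarrow>
     p \<noteq> [] \<and> (\<exists>n. ballot_path m n p) \<and> (\<forall>k. 0 < k \<and> k < length p \<longrightarrow> level m p k \<noteq> 0)"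

text \<open>A primitive path is nonempty and hence starts with a vertical step, and among all factors
  starting right after a given step at most one is primitive: the one ending at the first return to
  the line through the starting point.\<close>

definition rotation :: "nat \<Rightarrow> nat \<Rightarrow> path \<Rightarrow> path \<Rightarrow> bool" where
  "rotation m n P Q \<longleftrightarrow> ballot_path m n P \<and> ballot_path m n Q \<and>
     (\<exists>u p v. primitive_path m p \<and> P = u @ [Hor] @ p @ v \<and> Q = u @ p @ [Hor] @ v)"

definition tamari_le :: "nat \<Rightarrow> nat \<Rightarrow> path \<Rightarrow> path \<Rightarrow> bool" where
  "tamari_le m n P Q \<longleftrightarrow> ballot_path m n P \<and> ballot_path m n Q \<and> (rotation m n)\<^sup>*\<^sup>* P Q"

definition tamari_less :: "nat \<Rightarrow> nat \<Rightarrow> path \<Rightarrow> path \<Rightarrow> bool" where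
  "tamari_less m n P Q \<longleftrightarrow> tamari_le m n P Q \<and> P \<noteq> Q"

definition tamari_covers :: "nat \<Rightarrow> nat \<Rightarrow> path \<Rightarrow> path \<Rightarrow> bool" where
  "tamari_covers m n P Q \<longleftrightarrow>
     tamari_less m n P Q \<and> (\<nexists>R. tamari_less m n P R \<and> tamari_less m n R Q)"

definition tamari_intervals :: "nat \<Rightarrow> nat \<Rightarrow> (path \<times> path) set" where
  "tamari_intervals m n = {(P, Q). tamari_le m n P Q}"

definition tamari_dist :: "nat \<Rightarrow> nat \<Rightarrow> path \<times> path \<Rightarrow> nat" where
  "tamari_dist m n I = Max {k. (tamari_covers m n ^^ k) (fst I) (snd I)}"

definition mcontacts :: "nat \<Rightarrow> path \<Rightarrow> nat" where
  "mcontacts m w = card {k. k < length w \<and> level m w k = 0}"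

definition mrises :: "path \<Rightarrow> nat" where
  "mrises w = length (takeWhile (\<lambda>s. s = Vert) w)"

text \<open>Step number \<open>k\<close> (counted from \<open>0\<close>) goes from the \<open>k\<close>-th to the \<open>(k + 1)\<close>-st point.\<close>

definition step_positions :: "step \<Rightarrow> path \<Rightarrow> nat list" where
  "step_positions s w = filter (\<lambda>k. w ! k = s) [0..<length w]"

text \<open>Below, \<open>k\<close> is the position of a vertical step. The portion of the path weakly above the line
  runs from point \<open>k + 1\<close> to point \<open>portion_end m w k j\<close>.\<close>

definition portion_end :: "nat \<Rightarrow> path \<Rightarrow> nat \<Rightarrow> nat \<Rightarrow> nat" where
  "portion_end m w k j =
     Max {r. k < r \<and> r \<le> length w \<and> (\<forall>s. k < s \<and> s \<le> r \<longrightarrow> level m w k + int j \<le> level m w s)}"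

definition step_contacts :: "nat \<Rightarrow> path \<Rightarrow> nat \<Rightarrow> nat \<Rightarrow> nat" where
  "step_contacts m w k j =
     card {s. k < s \<and> s \<le> portion_end m w k j \<and> level m w s = level m w k + int j} - 1"

definition step_rises :: "path \<Rightarrow> nat \<Rightarrow> nat" where
  "step_rises w k = length (takeWhile (\<lambda>s. s = Vert) (drop (Suc k) w))"

text \<open>In the following two vectors, \<^const>\<open>butlast\<close> removes the entries \<open>c\<^sub>n\<^sub>,\<^sub>m\<close> and \<open>r\<^sub>n\<^sub>m\<close>. For a
  path of size \<open>n\<close> both have length \<open>n m\<close>; in particular they are empty for the empty path.\<close>

definition contact_vector :: "nat \<Rightarrow> path \<Rightarrow> nat list" where
  "contact_vector m w =
     butlast (mcontacts m w #
       concat (map (\<lambda>k. map (step_contacts m w k) [1..<Suc m]) (step_positions Vert w)))"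

definition rise_vector :: "path \<Rightarrow> nat list" where
  "rise_vector w = butlast (mrises w # map (step_rises w) (step_positions Hor w))"

definition mContactMon :: "nat \<Rightarrow> path \<Rightarrow> (nat \<Rightarrow> 'a::comm_semiring_1) \<Rightarrow> 'a" where
  "mContactMon m w X = prod_list (map X (contact_vector m w))"

definition mRiseMon :: "path \<Rightarrow> (nat \<Rightarrow> 'a::comm_semiring_1) \<Rightarrow> 'a" where
  "mRiseMon w Y = prod_list (map Y (rise_vector w))"

text \<open>The variable \<open>t\<close> is the indeterminate of the power series: the coefficient of \<open>t\<^sup>n\<close> is the
  (finite) sum over the intervals of size \<open>n\<close>.\<close>

definition Phi ::
    "nat \<Rightarrow> 'a \<Rightarrow> 'a \<Rightarrow> (nat \<Rightarrow> 'a) \<Rightarrow> (nat \<Rightarrow> 'a) \<Rightarrow> 'a \<Rightarrow> 'a::comm_semiring_1 fps" where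
  "Phi m x y X Y q = Abs_fps (\<lambda>n. \<Sum>I\<in>tamari_intervals m n.
     x ^ mcontacts m (fst I) * y ^ mrises (snd I) *
     mContactMon m (fst I) X * mRiseMon (snd I) Y * q ^ tamari_dist m n I)"

datatype indet = Ind_x | Ind_y | Ind_q | Ind_X nat | Ind_Y nat

type_synonym mpoly = "(indet \<Rightarrow>\<^sub>0 nat) \<Rightarrow>\<^sub>0 int"

definition Var :: "indet \<Rightarrow> mpoly" where
  "Var v = Poly_Mapping.single (Poly_Mapping.single v 1) 1"

text \<open>The sets under \<^const>\<open>sum\<close> and \<^const>\<open>Max\<close> in \<^const>\<open>Phi\<close> and \<^const>\<open>tamari_dist\<close> are finite,
  and the order is antisymmetric: a rotation increases the number of pairs of a vertical step and a
  later horizontal step.\<close>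

lemma length_ballot_path: "ballot_path m n w \<Longrightarrow> length w = n + n * m"
proof -
  have "length w = count_list w Vert + count_list w Hor" for w
  proof (induction w)
    case (Cons s w)
    then show ?case by (cases s) auto
  qed simp
  then show "ballot_path m n w \<Longrightarrow> length w = n + n * m"
    by (simp add: ballot_path_def)
qed

lemma finite_tamari_intervals: "finite (tamari_intervals m n)"
proof -
  have *: "(UNIV :: step set) = {Vert, Hor}"
    using step.exhaust by auto
  have "finite {w :: path. set w \<subseteq> UNIV \<and> length w = n + n * m}"
    by (rule finite_lists_length_eq) (simp add: *)
  moreover have "tamari_intervals m n \<subseteq>
      {w. set w \<subseteq> UNIV \<and> length w = n + n * m} \<times> {w. set w \<subseteq> UNIV \<and> length w = n + n * m}"
    by (auto simp: tamari_intervals_def tamari_le_def length_ballot_path)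
  ultimately show ?thesis
    by (meson finite_SigmaI finite_subset)
qed

fun vh_pairs :: "path \<Rightarrow> nat" where
  "vh_pairs [] = 0"
| "vh_pairs (Vert # w) = count_list w Hor + vh_pairs w"
| "vh_pairs (Hor # w) = vh_pairs w"

lemma vh_pairs_append:
  "vh_pairs (u @ v) = vh_pairs u + count_list u Vert * count_list v Hor + vh_pairs v"
  by (induction u rule: vh_pairs.induct) (auto simp: algebra_simps)

lemma vh_pairs_rotation:
  assumes "rotation m n P Q"
  shows "vh_pairs P < vh_pairs Q"
proof -
  obtain u p v where p: "primitive_path m p"
    and PQ: "P = u @ [Hor] @ p @ v" "Q = u @ p @ [Hor] @ v"
    using assms by (auto simp: rotation_def)
  obtain n' where n': "ballot_path m n' p" and "p \<noteq> []"
    using p by (auto simp: primitive_path_def)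
  then have "n' \<noteq> 0"
    using length_ballot_path[OF n'] by (cases n') auto
  then have "count_list p Vert > 0"
    using n' by (simp add: ballot_path_def)
  then show ?thesis
    by (simp add: PQ vh_pairs_append algebra_simps)
qed

lemma vh_pairs_tamari_le: "tamari_le m n P Q \<Longrightarrow> P = Q \<or> vh_pairs P < vh_pairs Q"
proof -
  have "(rotation m n)\<^sup>*\<^sup>* P Q \<Longrightarrow> P = Q \<or> vh_pairs P < vh_pairs Q"
  proof (induction rule: rtranclp_induct)
    case (step R S)
    then show ?case
      using vh_pairs_rotation[of m n R S] by auto
  qed simp
  then show "tamari_le m n P Q \<Longrightarrow> P = Q \<or> vh_pairs P < vh_pairs Q"
    by (simp add: tamari_le_def)
qed

lemma tamari_le_antisym: "tamari_le m n P Q \<Longrightarrow> tamari_le m n Q P \<Longrightarrow> P = Q"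
  using vh_pairs_tamari_le[of m n P Q] vh_pairs_tamari_le[of m n Q P] by auto

lemma vh_pairs_covers: "(tamari_covers m n ^^ k) P Q \<Longrightarrow> vh_pairs P + k \<le> vh_pairs Q"
proof (induction k arbitrary: Q)
  case (Suc k)
  then obtain R where R: "(tamari_covers m n ^^ k) P R" "tamari_covers m n R Q"
    by auto
  then have "vh_pairs R < vh_pairs Q"
    using vh_pairs_tamari_le[of m n R Q] by (auto simp: tamari_covers_def tamari_less_def)
  then show ?case
    using Suc.IH[OF R(1)] by simp
qed simp

lemma finite_chain_lengths: "finite {k. (tamari_covers m n ^^ k) P Q}"
proof (rule finite_subset)
  show "{k. (tamari_covers m n ^^ k) P Q} \<subseteq> {..vh_pairs Q}"
    using vh_pairs_covers[of _ m n P Q] by fastforce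
qed simp

lemma chain_lengths_nonempty:
  assumes "tamari_le m n P Q"
  shows "{k. (tamari_covers m n ^^ k) P Q} \<noteq> {}"
proof -
  have "\<exists>k. (tamari_covers m n ^^ k) P Q"
    using assms
  proof (induction "vh_pairs Q - vh_pairs P" arbitrary: P Q rule: less_induct)
    case less
    show ?case
    proof (cases "P = Q")
      case True
      then have "(tamari_covers m n ^^ 0) P Q" by simp
      then show ?thesis by blast
    next
      case False
      show ?thesis
      proof (cases "tamari_covers m n P Q")
        case True
        then have "(tamari_covers m n ^^ 1) P Q" by (simp add: OO_def)
        then show ?thesis by blast
      next
        case no_cover: False
        then obtain R where R: "tamari_less m n P R" "tamari_less m n R Q"
          using False less.prems by (auto simp: tamari_covers_def tamari_less_def)
        then have lt: "vh_pairs P < vh_pairs R" "vh_pairs R < vh_pairs Q"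
          using vh_pairs_tamari_le[of m n P R] vh_pairs_tamari_le[of m n R Q]
          by (auto simp: tamari_less_def)
        obtain k where k: "(tamari_covers m n ^^ k) P R"
          using less.hyps[of R P] diff_less_mono[of "vh_pairs R" "vh_pairs Q" "vh_pairs P"] lt R
          by (auto simp: tamari_less_def)
        obtain l where l: "(tamari_covers m n ^^ l) R Q"
          using less.hyps[of Q R] diff_less_mono2[of "vh_pairs P" "vh_pairs R" "vh_pairs Q"] lt R
          by (auto simp: tamari_less_def)
        have "(tamari_covers m n ^^ (k + l)) P Q"
          using k l by (auto simp: relpowp_add)
        then show ?thesis by blast
      qed
    qed
  qed
  then show ?thesis by simp
qed

end

theory Submission
  imports Defs
begin

unbundle fps_syntax

text \<open>
  Let \<open>f\<^sub>k(x)\<close> be the generating function, in \<open>t\<close> and \<open>x\<close>, of the intervals whose upper path has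
  initial rise \<open>k\<close>, where \<open>x\<close> marks the contacts of the lower path, each remaining contact number \<open>a\<close>
  contributes \<open>X\<^sub>a\<close>, each remaining rise \<open>b\<close> contributes \<open>Y\<^sub>b\<close>, and the distance is marked by \<open>q\<close>.
  Cutting the upper path where it first reaches each lower level gives \<open>f\<^sub>0 = 1\<close> and \<open>f\<^sub>k\<^sub>+\<^sub>1 = T f\<^sub>k\<close>, where
  \<open>T g = t x A\<^sup>m g\<close>, \<open>R = \<Sum>\<^sub>b Y\<^sub>b f\<^sub>b\<close> and, with \<open>D\<close> the operator dividing by \<open>x\<close> and dropping the constant
  term, \<open>(A g)(x) = R(x) (\<Sum>\<^sub>a X\<^sub>a D\<^sup>a g)(q x)\<close>.

  From \<open>A (x h) = q x A h + R l\<close>, where \<open>l\<close> is the constant term of \<open>\<Sum>\<^sub>a X\<^sub>a D\<^sup>a (x h)\<close>, one gets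
  \<open>A f\<^sub>k = \<Sum>\<^sub>p\<^sub>\<le>\<^sub>k l\<^sub>p q\<^bsup>k-p\<^esup> \<Sum>\<^sub>b Y\<^sub>b f\<^sub>k\<^sub>-\<^sub>p\<^sub>+\<^sub>b\<close>: on the index \<open>k\<close>, the operator \<open>A\<close> acts
  exactly as it acts on the exponent of \<open>x\<close>, with the roles of \<open>X\<close> and \<open>Y\<close> exchanged. Induction on the
  degree in \<open>t\<close> then shows that the coefficient of \<open>x\<^sup>i\<close> in \<open>A\<^sup>j f\<^sub>k\<close> is symmetric under exchanging
  \<open>i\<close> with \<open>k\<close> and \<open>X\<close> with \<open>Y\<close>; the theorem is the case \<open>j = 0\<close>.
\<close>

section \<open>Symmetry of the operator recursion\<close>

text \<open>Sequences \<open>nat \<Rightarrow> 'b\<close> are the coefficient sequences of power series in \<open>x\<close>. The bound \<open>B\<close> makes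
  \<open>\<Sum>\<^sub>a X\<^sub>a D\<^sup>a\<close> a finite sum; the alphabets will vanish beyond \<open>B\<close>.\<close>

definition shift_seq :: "(nat \<Rightarrow> 'b::comm_ring_1) \<Rightarrow> nat \<Rightarrow> 'b" where
  "shift_seq g i = (case i of 0 \<Rightarrow> 0 | Suc i' \<Rightarrow> g i')"

definition step_op ::
    "nat \<Rightarrow> 'b::comm_ring_1 \<Rightarrow> (nat \<Rightarrow> 'b) \<Rightarrow> (nat \<Rightarrow> 'b) \<Rightarrow> (nat \<Rightarrow> 'b) \<Rightarrow> nat \<Rightarrow> 'b" where
  "step_op B q R X g i = (\<Sum>p\<le>i. R p * q ^ (i - p) * (\<Sum>a\<le>B. X a * g (i - p + a)))"

text \<open>For \<open>p < i\<close> the argument of the shifted sequence is positive, so the shift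
  only lowers it by one and a factor \<open>q\<close> comes out; the summand \<open>p = i\<close>
  carries \<open>q ^ 0\<close> and stays apart.\<close>

lemma step_op_shift:
  "step_op B q R X (shift_seq g) i =
     q * shift_seq (step_op B q R X g) i + R i * (\<Sum>a\<le>B. X a * shift_seq g a)"
proof (cases i)
  case 0
  then show ?thesis by (simp add: step_op_def shift_seq_def)
next
  case (Suc i')
  have "(\<Sum>p\<le>i'. R p * q ^ (Suc i' - p) * (\<Sum>a\<le>B. X a * shift_seq g (Suc i' - p + a)))
      = q * (\<Sum>p\<le>i'. R p * q ^ (i' - p) * (\<Sum>a\<le>B. X a * g (i' - p + a)))"
    unfolding sum_distrib_left[of q]
    by (rule sum.cong) (auto simp: Suc_diff_le shift_seq_def algebra_simps)
  then show ?thesis by (simp add: Suc step_op_def shift_seq_def)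
qed

lemma step_op_linear:
  "step_op B q R X (\<lambda>i. \<Sum>s\<in>S. k s * g s i) = (\<lambda>i. \<Sum>s\<in>S. k s * step_op B q R X (g s) i)"
proof
  fix i
  have "step_op B q R X (\<lambda>i. \<Sum>s\<in>S. k s * g s i) i =
      (\<Sum>p\<le>i. \<Sum>a\<le>B. \<Sum>s\<in>S. k s * (R p * q ^ (i - p) * (X a * g s (i - p + a))))"
    unfolding step_op_def sum_distrib_left by (simp add: algebra_simps)
  also have "\<dots> = (\<Sum>s\<in>S. \<Sum>p\<le>i. \<Sum>a\<le>B. k s * (R p * q ^ (i - p) * (X a * g s (i - p + a))))"
    by (subst sum.swap[of _ _ S], rule sum.cong[OF refl], rule sum.swap)
  also have "\<dots> = (\<Sum>s\<in>S. k s * step_op B q R X (g s) i)"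
    unfolding step_op_def by (simp add: sum_distrib_left)
  finally show "step_op B q R X (\<lambda>i. \<Sum>s\<in>S. k s * g s i) i
      = (\<Sum>s\<in>S. k s * step_op B q R X (g s) i)" .
qed

lemma step_op_funpow_linear:
  "(step_op B q R X ^^ j) (\<lambda>i. \<Sum>s\<in>S. k s * g s i) = (\<lambda>i. \<Sum>s\<in>S. k s * (step_op B q R X ^^ j) (g s) i)"
  by (induction j) (simp_all add: step_op_linear)

text \<open>The system is implicit: \<open>R\<close> collects the series \<open>f b\<close>, while
  the operator producing \<open>f\<close> involves \<open>R\<close>. With \<open>fps_X\<close> for
  \<open>t\<close>, the factor \<open>t\<close> allows arguments degree by degree.\<close>

definition operator_system ::
    "nat \<Rightarrow> nat \<Rightarrow> 'b::comm_ring_1 \<Rightarrow> 'b \<Rightarrow> (nat \<Rightarrow> 'b) \<Rightarrow> (nat \<Rightarrow> 'b) \<Rightarrow> (nat \<Rightarrow> 'b) \<Rightarrow>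
      (nat \<Rightarrow> nat \<Rightarrow> 'b) \<Rightarrow> bool" where
  "operator_system m B t q X Y R f \<longleftrightarrow>
     f 0 = (\<lambda>i. if i = 0 then 1 else 0) \<and>
     (\<forall>k. f (Suc k) = (\<lambda>i. t * shift_seq ((step_op B q R X ^^ m) (f k)) i)) \<and>
     (\<forall>p. R p = (\<Sum>b\<le>B. Y b * f b p))"

text \<open>Induction on \<open>k\<close>. The operator commutes with its own \<open>m\<close>-th
  power, so the induction hypothesis passes through the recursion for \<open>f (Suc k)\<close> and
  raises each index \<open>k - p + b\<close> by one. The extra term of \<open>step_op_shift\<close>
  is a constant times \<open>R\<close>, that is, times the sum of all \<open>Y b * f b\<close>:
  exactly the new summand \<open>p = Suc k\<close>.\<close>

lemma step_op_dual:
  assumes "operator_system m B t q X Y R f"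
  shows "step_op B q R X (f k) = (\<lambda>i. \<Sum>p\<le>k. (\<Sum>a\<le>B. X a * f p a) * q ^ (k - p) *
            (\<Sum>b\<le>B. Y b * f (k - p + b) i))"
proof (induction k)
  case 0
  have f0: "f 0 = (\<lambda>i. if i = 0 then 1 else 0)" and R: "R p = (\<Sum>b\<le>B. Y b * f b p)" for p
    using assms by (auto simp: operator_system_def)
  have X0: "(\<Sum>a\<le>B. X a * f 0 (d + a)) = (if d = 0 then X 0 else 0)" for d
  proof (cases "d = 0")
    case True
    have "(\<Sum>a\<le>B. X a * f 0 (d + a)) = (\<Sum>a\<le>B. if a = 0 then X 0 else 0)"
      by (rule sum.cong) (auto simp: f0 True)
    then show ?thesis by (simp add: True)
  next
    case False
    then show ?thesis by (simp add: f0)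
  qed
  show ?case
  proof
    fix i
    have "step_op B q R X (f 0) i = (\<Sum>p\<le>i. if p = i then R i * X 0 else 0)"
      unfolding step_op_def X0 by (rule sum.cong) auto
    then show "step_op B q R X (f 0) i = (\<Sum>p\<le>0. (\<Sum>a\<le>B. X a * f p a) * q ^ (0 - p) *
            (\<Sum>b\<le>B. Y b * f (0 - p + b) i))"
      using X0[of 0] by (simp add: R mult.commute)
  qed
next
  case (Suc k)
  let ?A = "step_op B q R X"
  let ?l = "\<lambda>p. \<Sum>a\<le>B. X a * f p a"
  have fS: "f (Suc k) = (\<lambda>i. t * shift_seq ((?A ^^ m) (f k)) i)" for k
    using assms by (auto simp: operator_system_def)
  have R: "R p = (\<Sum>b\<le>B. Y b * f b p)" for p
    using assms by (auto simp: operator_system_def)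
  have lin1: "?A (\<lambda>i. c * g i) = (\<lambda>i. c * ?A g i)" for c g
    using step_op_linear[of B q R X "\<lambda>_. c" "\<lambda>_. g" "{()}"] by simp
  have Am: "?A ((?A ^^ m) (f k)) = (\<lambda>i. \<Sum>p\<le>k. ?l p * q ^ (k - p) *
            (\<Sum>b\<le>B. Y b * (?A ^^ m) (f (k - p + b)) i))"
  proof -
    have "?A ((?A ^^ m) (f k)) = (?A ^^ m) (?A (f k))"
      by (simp add: funpow_swap1)
    also have "\<dots> = (?A ^^ m) (\<lambda>i. \<Sum>p\<le>k. ?l p * q ^ (k - p) *
            (\<Sum>b\<le>B. Y b * f (k - p + b) i))"
      by (simp add: Suc.IH)
    finally show ?thesis by (simp add: step_op_funpow_linear)
  qed
  show ?case
  proof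
    fix i
    have "?A (f (Suc k)) i = t * ?A (shift_seq ((?A ^^ m) (f k))) i"
      unfolding fS lin1 ..
    also have "\<dots> = q * (t * shift_seq (?A ((?A ^^ m) (f k))) i) + R i * ?l (Suc k)"
      unfolding step_op_shift fS by (simp add: algebra_simps sum_distrib_left)
    also have "t * shift_seq (?A ((?A ^^ m) (f k))) i =
        (\<Sum>p\<le>k. ?l p * q ^ (k - p) * (\<Sum>b\<le>B. Y b * f (Suc (k - p + b)) i))"
      unfolding Am fS
      by (cases i) (auto simp: shift_seq_def sum_distrib_left algebra_simps)
    also have "q * \<dots> = (\<Sum>p\<le>k. ?l p * q ^ (Suc k - p) * (\<Sum>b\<le>B. Y b * f (Suc k - p + b) i))"
      unfolding sum_distrib_left[of q] by (rule sum.cong) (auto simp: Suc_diff_le algebra_simps)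
    finally show "?A (f (Suc k)) i = (\<Sum>p\<le>Suc k. ?l p * q ^ (Suc k - p) *
            (\<Sum>b\<le>B. Y b * f (Suc k - p + b) i))"
      by (simp add: R[of i] mult.commute)
  qed
qed

text \<open>The innermost application is rewritten by \<open>step_op_dual\<close>, the others pass
  through by linearity. The right-hand side has the shape of an unfolded \<open>step_op\<close> with
  \<open>X\<close> and \<open>Y\<close> exchanged and \<open>k\<close> in the place of the
  exponent.\<close>

lemma step_op_funpow_dual:
  assumes "operator_system m B t q X Y R f"
  shows "(step_op B q R X ^^ Suc j) (f k) i = (\<Sum>p\<le>k. (\<Sum>a\<le>B. X a * f p a) * q ^ (k - p) *
            (\<Sum>b\<le>B. Y b * (step_op B q R X ^^ j) (f (k - p + b)) i))"
proof -
  have "(step_op B q R X ^^ Suc j) (f k) = (step_op B q R X ^^ j) (step_op B q R X (f k))"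
    by (simp add: funpow_swap1)
  also have "\<dots> = (\<lambda>i. \<Sum>p\<le>k. (\<Sum>a\<le>B. X a * f p a) * q ^ (k - p) *
            (\<Sum>b\<le>B. Y b * (step_op B q R X ^^ j) (f (k - p + b)) i))"
    unfolding step_op_dual[OF assms] by (simp add: step_op_funpow_linear)
  finally show ?thesis by simp
qed

section \<open>Agreement of power series up to a given degree, and the symmetry\<close>

lemma fps_mult_nth_cong:
  fixes f g f' g' :: "'a::comm_ring_1 fps"
  assumes "\<forall>k<n. f $ k = f' $ k" "\<forall>k<n. g $ k = g' $ k"
  shows "\<forall>k<n. (f * g) $ k = (f' * g') $ k"
  using assms by (auto simp: fps_mult_nth intro!: sum.cong)

lemma fps_sum_nth_cong:
  fixes f f' :: "'s \<Rightarrow> 'a::comm_ring_1 fps"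
  assumes "\<And>s. s \<in> S \<Longrightarrow> \<forall>k<n. f s $ k = f' s $ k"
  shows "\<forall>k<n. (\<Sum>s\<in>S. f s) $ k = (\<Sum>s\<in>S. f' s) $ k"
  using assms by (auto simp: fps_sum_nth intro!: sum.cong)

text \<open>Outer induction on the number \<open>n\<close> of coefficients known to agree, inner
  induction on \<open>j\<close>. All powers \<open>j\<close> are treated at once because
  \<open>f (Suc k)\<close> contains the \<open>m\<close>-th power.\<close>

lemma operator_system_symmetric:
  fixes f f' :: "nat \<Rightarrow> nat \<Rightarrow> 'a::comm_ring_1 fps"
  assumes S: "operator_system m B fps_X q X Y R f"
    and S': "operator_system m B fps_X q Y X R' f'"
  shows "f k i = f' i k"
proof -
  let ?A = "step_op B q R X" and ?A' = "step_op B q R' Y"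
  have "\<forall>j i k. \<forall>n'<n. (?A ^^ j) (f k) i $ n' = (?A' ^^ j) (f' i) k $ n'" for n
  proof (induction n)
    case 0
    then show ?case by simp
  next
    case (Suc n)
    \<comment> \<open>Only here is a degree gained: for positive \<open>k\<close> and
      \<open>i\<close> both sides are \<open>fps_X\<close> times \<open>m\<close>-th powers, which
      agree below degree \<open>n\<close>.\<close>
    have base: "\<forall>n'<Suc n. f k i $ n' = f' i k $ n'" for i k
    proof (cases "k = 0 \<or> i = 0")
      case True
      have "f (Suc a) 0 = 0" "f' (Suc a) 0 = 0" for a
        using S S' by (auto simp: operator_system_def shift_seq_def)
      then have "f k i = f' i k"
        using S S' True by (cases k; cases i) (auto simp: operator_system_def)
      then show ?thesis by simp
    next
      case False
      then obtain k' i' where [simp]: "k = Suc k'" "i = Suc i'"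
        by (meson not0_implies_Suc)
      have "f k i = fps_X * (?A ^^ m) (f k') i'" "f' i k = fps_X * (?A' ^^ m) (f' i') k'"
        using S S' by (auto simp: operator_system_def shift_seq_def)
      then show ?thesis using Suc.IH by auto
    qed
    have "\<forall>n'<Suc n. (?A ^^ j) (f k) i $ n' = (?A' ^^ j) (f' i) k $ n'" for j i k
    proof (induction j arbitrary: i k)
      case 0
      then show ?case using base by simp
    next
      case (Suc j)
      \<comment> \<open>The left side is expanded by definition along the exponent \<open>i\<close>,
        the right side by the dual formula along the index \<open>i\<close>; the two sums then match
        term by term.\<close>
      have "(?A ^^ Suc j) (f k) i = (\<Sum>p\<le>i. (\<Sum>b\<le>B. Y b * f b p) * q ^ (i - p) *
          (\<Sum>a\<le>B. X a * (?A ^^ j) (f k) (i - p + a)))"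
        using S by (simp add: step_op_def operator_system_def)
      moreover note step_op_funpow_dual[OF S', of j i k]
      moreover have "\<forall>n'<Suc n.
         (\<Sum>p\<le>i. (\<Sum>b\<le>B. Y b * f b p) * q ^ (i - p) *
            (\<Sum>a\<le>B. X a * (?A ^^ j) (f k) (i - p + a))) $ n' =
         (\<Sum>p\<le>i. (\<Sum>a\<le>B. Y a * f' p a) * q ^ (i - p) *
            (\<Sum>b\<le>B. X b * (?A' ^^ j) (f' (i - p + b)) k)) $ n'"
        by (intro fps_sum_nth_cong fps_mult_nth_cong base Suc.IH) simp_all
      ultimately show ?case by simp
    qed
    then show ?case by blast
  qed
  then have "f k i $ n = f' i k $ n" for n
    using lessI funpow_0 by metis
  then show ?thesis by (simp add: fps_eq_iff)
qed

section \<open>Paths descending to the base line and their rotations\<close>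

text \<open>The argument \<open>h\<close> is the height of the starting point above the base line; the path has to end
  on the base line and never go below it.\<close>

fun descent_path :: "nat \<Rightarrow> nat \<Rightarrow> path \<Rightarrow> bool" where
  "descent_path m h [] \<longleftrightarrow> h = 0"
| "descent_path m h (Vert # w) \<longleftrightarrow> descent_path m (h + m) w"
| "descent_path m 0 (Hor # w) \<longleftrightarrow> False"
| "descent_path m (Suc h) (Hor # w) \<longleftrightarrow> descent_path m h w"

text \<open>Counts the points at height \<open>0\<close> that are followed by a vertical step, up to the first descent
  below the base line; for the portion above the base line these are the contacts but the last.\<close>

fun base_contacts :: "nat \<Rightarrow> nat \<Rightarrow> path \<Rightarrow> nat" where
  "base_contacts m h [] = 0"
| "base_contacts m h (Vert # w) = (if h = 0 then 1 else 0) + base_contacts m (h + m) w"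
| "base_contacts m 0 (Hor # w) = 0"
| "base_contacts m (Suc h) (Hor # w) = base_contacts m h w"

text \<open>The rise vector with its final entry kept.\<close>

fun runs :: "path \<Rightarrow> nat list" where
  "runs [] = [0]"
| "runs (Hor # w) = 0 # runs w"
| "runs (Vert # w) = Suc (hd (runs w)) # tl (runs w)"

text \<open>The contact vector without its head and with its final entry kept: a vertical step ends
  at height \<open>m - j\<close> above its \<open>j\<close>-th line.\<close>

fun vert_contacts :: "nat \<Rightarrow> path \<Rightarrow> nat list" where
  "vert_contacts m [] = []"
| "vert_contacts m (Vert # w) = map (\<lambda>j. base_contacts m (m - j) w) [1..<Suc m] @ vert_contacts m w"
| "vert_contacts m (Hor # w) = vert_contacts m w"

text \<open>Rotation freed from the ambient ballot path, so that it applies to factors starting at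
  any height. A single counted contact expresses that \<open>p\<close> is primitive.\<close>

definition rot :: "nat \<Rightarrow> path \<Rightarrow> path \<Rightarrow> bool" where
  "rot m P Q \<longleftrightarrow> (\<exists>u p v. descent_path m 0 p \<and> base_contacts m 0 p = 1 \<and>
     P = u @ [Hor] @ p @ v \<and> Q = u @ p @ [Hor] @ v)"

section \<open>Concatenating paths and cutting them at the base line\<close>

lemma runs_nonempty [simp]: "runs w \<noteq> []"
  by (induction w rule: runs.induct) auto

lemma runs_append_Hor: "runs (u @ Hor # v) = runs u @ runs v"
  by (induction u rule: runs.induct) auto

text \<open>Started \<open>h\<close> higher, \<open>u\<close> stays at height at least
  \<open>h\<close> and ends there, so only \<open>v\<close> decides.\<close>

lemma descent_path_append: "descent_path m j u \<Longrightarrow> descent_path m (j + h) (u @ v) = descent_path m h v"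
  by (induction m j u rule: descent_path.induct) (auto simp: add.assoc add.commute add.left_commute)

lemma descent_path_append0: "descent_path m j u \<Longrightarrow> descent_path m j (u @ v) = descent_path m 0 v"
  using descent_path_append[of m j u 0] by simp

lemma base_contacts_append_above:
  "descent_path m j u \<Longrightarrow> 0 < h \<Longrightarrow> base_contacts m (j + h) (u @ v) = base_contacts m h v"
  by (induction m j u rule: descent_path.induct) (auto simp: add.assoc add.commute add.left_commute)

lemma base_contacts_append:
  "descent_path m j u \<Longrightarrow> base_contacts m j (u @ v) = base_contacts m j u + base_contacts m 0 v"
  by (induction m j u rule: descent_path.induct) auto

text \<open>Started too low, the path drops below the base line within \<open>u\<close>, and
  counting stops there.\<close>

lemma base_contacts_append_below:
  "descent_path m j u \<Longrightarrow> h < j \<Longrightarrow> base_contacts m h (u @ v) = base_contacts m h u"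
proof (induction m j u arbitrary: h rule: descent_path.induct)
  case (4 m h' w)
  then show ?case by (cases h) auto
qed auto

lemma descent_path_not_below: "descent_path m j u \<Longrightarrow> h < j \<Longrightarrow> \<not> descent_path m h (u @ v)"
proof (induction m j u arbitrary: h rule: descent_path.induct)
  case (4 m h' w)
  then show ?case by (cases h) auto
qed auto

lemma base_contacts_append_Hor:
  "descent_path m j u \<Longrightarrow> base_contacts m j (u @ Hor # v) = base_contacts m j u"
  by (simp add: base_contacts_append)

lemma vert_contacts_append:
  "descent_path m j u \<Longrightarrow> vert_contacts m (u @ v) = vert_contacts m u @ vert_contacts m v"
proof (induction m j u rule: descent_path.induct)
  case (2 m h w)
  then show ?case by (auto simp: base_contacts_append_below)
qed auto

text \<open>The cut is at the first arrival at height 0. Up to that step all heights are at least 1,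
  and lowering them by one makes \<open>u\<close> a descent path.\<close>

lemma descent_path_Suc_split:
  "descent_path m (Suc j) w \<Longrightarrow> \<exists>u v. w = u @ Hor # v \<and> descent_path m j u \<and> descent_path m 0 v"
proof (induction w arbitrary: j)
  case (Cons s w)
  show ?case
  proof (cases s)
    case Vert
    then obtain u v where "w = u @ Hor # v" "descent_path m (j + m) u" "descent_path m 0 v"
      using Cons.IH[of "j + m"] Cons.prems by auto
    then show ?thesis using Vert by (intro exI[of _ "Vert # u"] exI[of _ v]) auto
  next
    case Hor
    show ?thesis
    proof (cases j)
      case 0
      then show ?thesis using Hor Cons.prems by (intro exI[of _ "[]"] exI[of _ w]) auto
    next
      case (Suc j')
      then obtain u v where "w = u @ Hor # v" "descent_path m j' u" "descent_path m 0 v"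
        using Cons.IH[of j'] Cons.prems Hor by auto
      then show ?thesis using Suc Hor by (intro exI[of _ "Hor # u"] exI[of _ v]) auto
    qed
  qed
qed simp

lemma append_eq_cases:
  assumes "a @ x = b @ y"
  obtains c where "b = a @ c" "x = c @ y" | c where "a = b @ c" "c \<noteq> []" "y = c @ x"
proof -
  from assms consider c where "b = a @ c" "x = c @ y" | c where "a = b @ c" "y = c @ x"
    by (auto simp: append_eq_append_conv2)
  then show ?thesis
  proof cases
    case (2 c)
    then show ?thesis using that by (cases "c = []") auto
  qed (use that in auto)
qed

text \<open>A longer candidate for \<open>u\<close> would contain a step \<open>Hor\<close> taken
  from height 0.\<close>

lemma descent_path_prefix_unique:
  assumes "u @ Hor # v = u' @ Hor # v'" "descent_path m j u" "descent_path m j u'"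
  shows "u = u' \<and> v = v'"
proof -
  have *: "a = b" if eq: "a @ Hor # v = (a @ c) @ y" and "descent_path m j a" "descent_path m j b" "b = a @ c"
    for a b c v y
  proof (rule ccontr)
    assume "a \<noteq> b"
    then have "c \<noteq> []" using that by auto
    then obtain c' where "c = Hor # c'" using eq by (cases c) auto
    then show False using descent_path_append0[OF that(2), of c] that by simp
  qed
  from assms(1) show ?thesis
  proof (cases rule: append_eq_cases)
    case (1 c)
    then show ?thesis using *[of u v c "Hor # v'" u'] assms by simp
  next
    case (2 c)
    then show ?thesis using *[of u' v' c "Hor # v" u] assms by simp
  qed
qed

lemma base_contacts_eq_0: "descent_path m 0 u \<Longrightarrow> base_contacts m 0 u = 0 \<longleftrightarrow> u = []"
  by (cases u; cases "hd u") auto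

text \<open>The difference of the two prefixes is a closed path without contacts, hence
  empty.\<close>

lemma prefix_contacts_unique:
  assumes "u @ v = u' @ v'" "descent_path m j u" "descent_path m j u'"
    "base_contacts m j u = base_contacts m j u'"
  shows "u = u' \<and> v = v'"
proof -
  have *: "c = []" if "descent_path m j a" "descent_path m j (a @ c)"
    "base_contacts m j a = base_contacts m j (a @ c)" for a c
    using that by (simp add: descent_path_append0 base_contacts_append base_contacts_eq_0)
  from assms(1) show ?thesis
  proof (cases rule: append_eq_cases)
    case (1 c)
    then show ?thesis using *[of u c] assms by auto
  next
    case (2 c)
    then show ?thesis using *[of u' c] assms by auto
  qed
qed

lemma descent_path_contact_split:
  "descent_path m j w \<Longrightarrow> a \<le> base_contacts m j w \<Longrightarrow>
     \<exists>u v. w = u @ v \<and> descent_path m j u \<and> descent_path m 0 v \<and> base_contacts m j u = a"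
proof (induction m j w arbitrary: a rule: descent_path.induct)
  case (2 m h w)
  show ?case
  proof (cases "h = 0 \<and> a = 0")
    case True
    then show ?thesis using 2 by (intro exI[of _ "[]"] exI[of _ "Vert # w"]) auto
  next
    case False
    let ?e = "if h = 0 then 1 else 0 :: nat"
    have "a - ?e \<le> base_contacts m (h + m) w" using 2(3) by auto
    then obtain u v where "w = u @ v" "descent_path m (h + m) u" "descent_path m 0 v"
        "base_contacts m (h + m) u = a - ?e"
      using 2(1)[of "a - ?e"] 2(2) by auto
    then show ?thesis using False
      by (intro exI[of _ "Vert # u"] exI[of _ v]) auto
  qed
next
  case (4 m h w)
  from 4(1)[of a] 4(2,3) obtain u v where "w = u @ v" "descent_path m h u" "descent_path m 0 v"
        "base_contacts m h u = a" by fastforce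
  then show ?case by (intro exI[of _ "Hor # u"] exI[of _ v]) auto
qed auto

lemma descent_path_length:
  "descent_path m j w \<Longrightarrow> count_list w Hor = j + m * count_list w Vert"
  by (induction m j w rule: descent_path.induct) auto

lemma length_count: "length w = count_list w Vert + count_list w Hor"
proof (induction w)
  case (Cons s w)
  then show ?case by (cases s) auto
qed simp

lemma descent_path_primitive_split:
  assumes "descent_path m 0 w" "w \<noteq> []"
  shows "\<exists>p v. w = p @ v \<and> descent_path m 0 p \<and> base_contacts m 0 p = 1 \<and> descent_path m 0 v \<and>
           base_contacts m 0 w = Suc (base_contacts m 0 v)"
proof -
  have "1 \<le> base_contacts m 0 w"
    using base_contacts_eq_0[OF assms(1)] assms(2) by simp
  then obtain p v where "w = p @ v \<and> descent_path m 0 p \<and> descent_path m 0 v \<and> base_contacts m 0 p = 1"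
    using descent_path_contact_split[OF assms(1)] by blast
  then show ?thesis using base_contacts_append[of m 0 p v] by auto
qed

section \<open>Rotations acting on factors of a path\<close>

lemma rot_context: "rot m P Q \<Longrightarrow> rot m (a @ P @ b) (a @ Q @ b)"
proof -
  assume "rot m P Q"
  then obtain u p v where "descent_path m 0 p" "base_contacts m 0 p = 1"
      "P = u @ [Hor] @ p @ v" "Q = u @ p @ [Hor] @ v"
    unfolding rot_def by blast
  then show ?thesis unfolding rot_def
    by (intro exI[of _ "a @ u"] exI[of _ p] exI[of _ "v @ b"]) simp
qed

lemma rot_chain_context: "(rot m ^^ k) P Q \<Longrightarrow> (rot m ^^ k) (a @ P @ b) (a @ Q @ b)"
proof (induction k arbitrary: Q)
  case (Suc k)
  from Suc.prems obtain R where "(rot m ^^ k) P R" "rot m R Q" by auto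
  then show ?case using Suc.IH[of R] rot_context[of m R Q a b] by auto
qed auto

text \<open>\<open>w\<close> is a product of primitive paths, one for each contact, and each
  rotation carries the step over one of them.\<close>

lemma rot_chain_Hor:
  "descent_path m 0 w \<Longrightarrow> (rot m ^^ base_contacts m 0 w) (Hor # w) (w @ [Hor])"
proof (induction w rule: length_induct)
  case (1 w)
  show ?case
  proof (cases "w = []")
    case False
    then obtain p v where pv: "w = p @ v" "descent_path m 0 p" "base_contacts m 0 p = 1"
        "descent_path m 0 v" "base_contacts m 0 w = Suc (base_contacts m 0 v)"
      using descent_path_primitive_split 1(2) by blast
    have "p \<noteq> []" using pv(3) by auto
    then have "(rot m ^^ base_contacts m 0 v) (Hor # v) (v @ [Hor])"
      using 1(1) pv by auto
    from rot_chain_context[OF this, of p "[]"]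
    have "(rot m ^^ base_contacts m 0 v) (p @ Hor # v) (w @ [Hor])" by (simp add: pv)
    moreover have "rot m (Hor # w) (p @ Hor # v)"
      unfolding rot_def using pv by (intro exI[of _ "[]"] exI[of _ p] exI[of _ v]) auto
    ultimately show ?thesis unfolding pv(5) by (meson relpowp_Suc_I2)
  qed simp
qed

lemma rot_descent_path:
  assumes "rot m P Q" "descent_path m j P"
  shows "descent_path m j Q"
proof -
  have *: "descent_path m j (u @ Hor # p @ v) \<Longrightarrow> descent_path m 0 p \<Longrightarrow>
      descent_path m j (u @ p @ Hor # v)" for u p v j
  proof (induction m j u rule: descent_path.induct)
    case (1 m h)
    then show ?case
      by (cases h) (auto simp: descent_path_append[of m 0, simplified])
  qed auto
  show ?thesis using assms * unfolding rot_def by auto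
qed

text \<open>A rotation lifts \<open>p\<close> by one level. This removes the contacts of
  \<open>p\<close> if it started on the base line, and creates none.\<close>

lemma rot_base_contacts:
  assumes "rot m P Q" "descent_path m j P"
  shows "base_contacts m j Q \<le> base_contacts m j P"
proof -
  have *: "descent_path m j (u @ Hor # p @ v) \<Longrightarrow> descent_path m 0 p \<Longrightarrow>
      base_contacts m j (u @ p @ Hor # v) \<le> base_contacts m j (u @ Hor # p @ v)" for u p v j
  proof (induction m j u rule: descent_path.induct)
    case (1 m h)
    then obtain h' where h: "h = Suc h'" by (cases h) auto
    have "base_contacts m h (p @ Hor # v) = base_contacts m h' v"
      using base_contacts_append_above[OF 1(2), of h "Hor # v"] by (simp add: h)
    moreover have "base_contacts m h' v \<le> base_contacts m h' (p @ v)"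
      using base_contacts_append_above[OF 1(2), of h' v] base_contacts_append[OF 1(2), of v]
      by (cases h') auto
    ultimately show ?case by (simp add: h)
  qed auto
  show ?thesis using assms * unfolding rot_def by auto
qed

lemma rot_count: "rot m P Q \<Longrightarrow> count_list P s = count_list Q s"
  unfolding rot_def by auto

lemma rot_Vert:
  assumes "rot m P (Vert # Q)" "descent_path m 0 P"
  shows "\<exists>P'. P = Vert # P' \<and> rot m P' Q"
proof -
  obtain u p v where u: "descent_path m 0 p" "base_contacts m 0 p = 1" "P = u @ Hor # p @ v"
      "Vert # Q = u @ p @ Hor # v"
    using assms(1) unfolding rot_def by auto
  have "u \<noteq> []" using assms(2) u(3) by auto
  then obtain u' where u': "u = Vert # u'"
    using u(4) by (cases u) simp_all
  have "rot m (u' @ Hor # p @ v) Q"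
    unfolding rot_def using u(1,2,4) by (intro exI[of _ u'] exI[of _ p] exI[of _ v]) (simp add: u')
  then show ?thesis using u(3) u' by simp
qed

text \<open>\<open>P\<close> is cut at its first arrival at height 0; the rotated step lies before
  the cut step, after it, or is that step itself.\<close>

lemma rot_Suc_cases:
  assumes "rot m P Q" "descent_path m (Suc j) P"
  obtains (left) A A' B where "P = A @ Hor # B" "Q = A' @ Hor # B" "rot m A A'" "descent_path m j A"
      "descent_path m j A'" "descent_path m 0 B"
    | (right) A B B' where "P = A @ Hor # B" "Q = A @ Hor # B'" "rot m B B'" "descent_path m j A"
      "descent_path m 0 B" "descent_path m 0 B'"
    | (mid) A p B where "P = A @ Hor # p @ B" "Q = A @ p @ Hor # B" "descent_path m 0 p"
      "base_contacts m 0 p = 1" "descent_path m j A" "descent_path m 0 B"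
proof -
  obtain u p v where u: "descent_path m 0 p" "base_contacts m 0 p = 1" "P = u @ Hor # p @ v"
      "Q = u @ p @ Hor # v"
    using assms(1) unfolding rot_def by auto
  obtain A B where A: "P = A @ Hor # B" "descent_path m j A" "descent_path m 0 B"
    using descent_path_Suc_split[OF assms(2)] by blast
  have "u @ Hor # p @ v = A @ Hor # B" using u(3) A(1) by (rule subst)
  then show ?thesis
  proof (cases rule: append_eq_cases)
    case (1 c)
    show ?thesis
    proof (cases c)
      case Nil
      then have uA: "u = A" "B = p @ v" using 1 by simp_all
      then have v: "descent_path m 0 v"
        using A(3) descent_path_append0[OF u(1), of v] by simp
      show ?thesis
        by (rule mid[OF _ _ u(1,2) A(2) v]) (simp_all add: u(3,4) uA(1))
    next
      case (Cons s z)
      then have s: "s = Hor" "p @ v = z @ Hor # B" using 1(2) by simp_all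
      have Az: "A = u @ Hor # z" using 1(1) Cons s(1) by simp
      \<comment> \<open>As an end of \<open>A\<close>, \<open>z\<close> descends from some height to
        its base line. A \<open>p\<close> reaching beyond \<open>z\<close> would contain the step
        \<open>Hor\<close> that follows and so fall below its own starting point.\<close>
      have "\<exists>h. descent_path m h z"
      proof -
        have "descent_path m j (u @ x) \<Longrightarrow> \<exists>h. descent_path m h x" for x
          by (induction m j u rule: descent_path.induct) auto
        from this[of "Hor # z"] obtain h where "descent_path m h (Hor # z)"
          using A(2) Az by auto
        then show ?thesis by (cases h) auto
      qed
      then obtain h where h: "descent_path m h z" ..
      from s(2) show ?thesis
      proof (cases rule: append_eq_cases)
        case (1 d)
        have r: "rot m A (u @ p @ Hor # d)"
          unfolding rot_def using u(1,2) by (intro exI[of _ u] exI[of _ p] exI[of _ d]) (simp add: Az 1)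
        show ?thesis
          by (rule left[OF A(1) _ r A(2) rot_descent_path[OF r A(2)] A(3)]) (simp add: u(4) 1)
      next
        case (2 d)
        then obtain d' where d: "p = z @ Hor # d'" using 2(2,3) by (cases d) simp_all
        have False
        proof (cases h)
          case 0
          then show ?thesis using h d u(1) descent_path_append0[of m 0 z] by simp
        next
          case (Suc h')
          then show ?thesis using descent_path_not_below[OF h, of 0] u(1) d by simp
        qed
        then show ?thesis ..
      qed
    qed
  next
    case (2 c)
    then obtain c' where c: "u = A @ Hor # c'" "B = c' @ Hor # p @ v" by (cases c) simp_all
    have r: "rot m B (c' @ p @ Hor # v)"
      unfolding rot_def using u(1,2) by (intro exI[of _ c'] exI[of _ p] exI[of _ v]) (simp add: c)
    show ?thesis
      by (rule right[OF A(1) _ r A(2,3) rot_descent_path[OF r A(3)]]) (simp add: u(4) c)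
  qed
qed

text \<open>The boundary between \<open>P2\<close> and \<open>P3\<close> has height 0, but in the
  rotated word the points from \<open>p\<close> up to the following \<open>Hor\<close> have height
  at least 1. So the boundary misses them, and the rotation takes place inside one of the two
  factors.\<close>

lemma rot_append_cases:
  assumes "rot m B (P2 @ P3)" "descent_path m 0 B" "descent_path m 0 P2"
  shows "(\<exists>P2'. B = P2' @ P3 \<and> rot m P2' P2 \<and> descent_path m 0 P2') \<or> (\<exists>P3'. B = P2 @ P3' \<and> rot m P3' P3)"
proof -
  obtain u p v where u: "descent_path m 0 p" "base_contacts m 0 p = 1" "B = u @ Hor # p @ v"
      "P2 @ P3 = u @ p @ Hor # v"
    using assms(1) unfolding rot_def by auto
  from u(4) show ?thesis
  proof (cases rule: append_eq_cases)
    case (1 c)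
    then have "rot m (c @ Hor # p @ v) P3" unfolding rot_def using u by auto
    then show ?thesis using 1 u by auto
  next
    case (2 y)
    from 2(3) have "p @ Hor # v = y @ P3" .
    then show ?thesis
    proof (cases rule: append_eq_cases)
      case (1 c)
      show ?thesis
      proof (cases c)
        case Nil
        have "\<not> descent_path m j (u @ p)" if "descent_path m j (u @ Hor # p @ v)" for j
          using that u(1)
        proof (induction m j u rule: descent_path.induct)
          case (1 m h)
          then show ?case using descent_path_append[of m 0 p h "[]"] by (cases h) auto
        qed auto
        then show ?thesis using assms 2 u 1 Nil by auto
      next
        case (Cons s z)
        then have y: "y = p @ Hor # z" "v = z @ P3" using 1 by auto
        then have r: "rot m (u @ Hor # p @ z) P2" unfolding rot_def using u 2 by auto
        have "descent_path m j (u @ Hor # p @ z)" if "descent_path m j (u @ p @ Hor # z)" 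
           "descent_path m j (u @ Hor # p @ v)" for j
          using that u(1)
        proof (induction m j u rule: descent_path.induct)
          case (1 m h)
          then show ?case using descent_path_append[of m 0 p _ "Hor # z"]  descent_path_append[of m 0 p _ z]
            by (cases h) auto
        qed auto
        then have "descent_path m 0 (u @ Hor # p @ z)" using assms 2 u y by auto
        then show ?thesis using r u y by auto
      qed
    next
      case (2 c)
      have "\<not> descent_path m j (u @ y)" if "descent_path m j (u @ Hor # p @ v)" for j
          using that u(1) 2
        proof (induction m j u rule: descent_path.induct)
          case (1 m h)
          then obtain h' where "h = Suc h'" by (cases h) auto
          then show ?case using descent_path_not_below[of m h y 0 c] 1 by auto
        qed auto
        then show ?thesis using assms 2 u \<open>P2 = u @ y\<close> by auto
    qed
  qed
qed

section \<open>Recursive description of intervals\<close>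

text \<open>In the last rule, \<open>Q1 @ [Hor]\<close> leads to the first point of the upper path on the base line. The
  step \<open>Hor\<close> of the lower path is rotated over the primitive factors of \<open>P2\<close>, one by one; doing this
  before anything else yields a longest chain, since rotations only decrease the number of contacts.\<close>

inductive interval :: "nat \<Rightarrow> nat \<Rightarrow> path \<Rightarrow> path \<Rightarrow> nat \<Rightarrow> bool" for m where
  Nil: "interval m 0 [] [] 0"
| Vert: "interval m m P Q d \<Longrightarrow> interval m 0 (Vert # P) (Vert # Q) d"
| Hor: "interval m j (P1 @ P2) Q1 d1 \<Longrightarrow> interval m 0 P3 Q2 d2 \<Longrightarrow>
    descent_path m j P1 \<Longrightarrow> descent_path m 0 P2 \<Longrightarrow>
    interval m (Suc j) (P1 @ Hor # P2 @ P3) (Q1 @ Hor # Q2) (d1 + d2 + base_contacts m 0 P2)"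

lemma interval_descent_path:
  "interval m j P Q d \<Longrightarrow> descent_path m j P \<and> descent_path m j Q \<and> count_list P Vert = count_list Q Vert"
proof (induction rule: interval.induct)
  case (Hor j P1 P2 Q1 d1 P3 Q2 d2)
  then show ?case
    using descent_path_append[of m j P1 1] descent_path_append[of m j Q1 1]
    by (auto simp: descent_path_append0)
qed auto

lemma interval_0_cases:
  assumes "interval m 0 P Q d"
  shows "P = [] \<and> Q = [] \<and> d = 0 \<or> (\<exists>P' Q'. P = Vert # P' \<and> Q = Vert # Q' \<and> interval m m P' Q' d)"
  using assms by cases auto

lemma interval_Suc_cases:
  assumes "interval m (Suc j) P Q d"
  obtains P1 P2 P3 Q1 Q2 d1 d2 where "P = P1 @ Hor # P2 @ P3" "Q = Q1 @ Hor # Q2"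
    "d = d1 + d2 + base_contacts m 0 P2" "interval m j (P1 @ P2) Q1 d1" "interval m 0 P3 Q2 d2"
    "descent_path m j P1" "descent_path m 0 P2"
  using assms by cases auto

text \<open>First arrivals at the base line fix \<open>Q1\<close> and \<open>P1\<close>. The cut
  between \<open>P2\<close> and \<open>P3\<close> is fixed by length: both paths of an interval have
  equally many vertical steps, so \<open>P3\<close> is as long as \<open>Q2\<close>.\<close>

lemma interval_Hor_unique:
  assumes "P1 @ Hor # P2 @ P3 = P1' @ Hor # P2' @ P3'" "Q1 @ Hor # Q2 = Q1' @ Hor # Q2'"
    "descent_path m j P1" "descent_path m j P1'" "interval m j (P1 @ P2) Q1 d1"
    "interval m j (P1' @ P2') Q1' d1'" "interval m 0 P3 Q2 d2" "interval m 0 P3' Q2' d2'"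
  shows "P1 = P1' \<and> P2 = P2' \<and> P3 = P3' \<and> Q1 = Q1' \<and> Q2 = Q2'"
proof -
  have Q: "Q1 = Q1'" "Q2 = Q2'"
    using descent_path_prefix_unique[OF assms(2)] interval_descent_path[OF assms(5)]
      interval_descent_path[OF assms(6)] by auto
  have P: "P1 = P1'" "P2 @ P3 = P2' @ P3'"
    using descent_path_prefix_unique[OF assms(1,3,4)] by auto
  have "length P3 = length P3'"
    using interval_descent_path[OF assms(7)] interval_descent_path[OF assms(8)] Q
    by (simp add: length_count descent_path_length[of m 0])
  then show ?thesis using P Q by simp
qed

lemma interval_dist_unique: "interval m j P Q d \<Longrightarrow> interval m j P Q d' \<Longrightarrow> d = d'"
proof (induction arbitrary: d' rule: interval.induct)
  case Nil
  then show ?case using interval_0_cases by blast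
next
  case (Vert P Q d)
  then show ?case using interval_0_cases by blast
next
  case (Hor j P1 P2 Q1 d1 P3 Q2 d2)
  from Hor.prems obtain P1' P2' P3' Q1' Q2' d1' d2' where
    *: "P1 @ Hor # P2 @ P3 = P1' @ Hor # P2' @ P3'" "Q1 @ Hor # Q2 = Q1' @ Hor # Q2'"
    "d' = d1' + d2' + base_contacts m 0 P2'" "interval m j (P1' @ P2') Q1' d1'" "interval m 0 P3' Q2' d2'"
    "descent_path m j P1'"
    by (rule interval_Suc_cases)
  from interval_Hor_unique[OF *(1,2) Hor.hyps(3) *(6) Hor.hyps(1) *(4) Hor.hyps(2) *(5)]
  show ?case using Hor.IH * by auto
qed

lemma interval_refl: "descent_path m j P \<Longrightarrow> interval m j P P 0"
proof (induction P arbitrary: j rule: length_induct)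
  case (1 P)
  show ?case
  proof (cases j)
    case 0
    show ?thesis
    proof (cases P)
      case Nil
      then show ?thesis using 0 interval.Nil by simp
    next
      case (Cons s P')
      then have "s = Vert" using 1(2) 0 by (cases s) auto
      then show ?thesis using 1 Cons 0 interval.Vert by auto
    qed
  next
    case (Suc j')
    then obtain u v where P: "P = u @ Hor # v" "descent_path m j' u" "descent_path m 0 v"
      using 1(2) descent_path_Suc_split by blast
    then have "interval m j' u u 0" "interval m 0 v v 0" using 1(1) by auto
    then show ?thesis using interval.Hor[of m j' u "[]" u 0 v v 0] P Suc by simp
  qed
qed

text \<open>The step \<open>Hor\<close> is first carried over \<open>P2\<close>; then
  \<open>P1 @ P2\<close> and \<open>P3\<close> are rotated in place.\<close>

lemma interval_rot_chain: "interval m j P Q d \<Longrightarrow> (rot m ^^ d) P Q"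
proof (induction rule: interval.induct)
  case (Vert P Q d)
  then show ?case using rot_chain_context[of d m P Q "[Vert]" "[]"] by simp
next
  case (Hor j P1 P2 Q1 d1 P3 Q2 d2)
  have "(rot m ^^ base_contacts m 0 P2) (P1 @ Hor # P2 @ P3) (P1 @ P2 @ Hor # P3)"
    using rot_chain_context[OF rot_chain_Hor[OF Hor.hyps(4)], of P1 P3] by simp
  moreover have "(rot m ^^ d1) (P1 @ P2 @ Hor # P3) (Q1 @ Hor # P3)"
    using rot_chain_context[OF Hor.IH(1), of "[]" "Hor # P3"] by simp
  moreover have "(rot m ^^ d2) (Q1 @ Hor # P3) (Q1 @ Hor # Q2)"
    using rot_chain_context[OF Hor.IH(2), of "Q1 @ [Hor]" "[]"] by simp
  ultimately have "(rot m ^^ (base_contacts m 0 P2 + d1 + d2)) (P1 @ Hor # P2 @ P3) (Q1 @ Hor # Q2)"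
    unfolding relpowp_add by blast
  then show ?case by (simp add: ac_simps)
qed auto

text \<open>This bounds the length of every rotation chain by \<open>d\<close>. A rotation inside
  \<open>P1\<close> or \<open>P3\<close> increases \<open>d1\<close> or \<open>d2\<close>; one
  inside \<open>P2\<close> increases \<open>d1\<close> without decreasing the contact term, by
  \<open>rot_base_contacts\<close>; one of the cut step moves \<open>p\<close> from the end of
  \<open>P1\<close> to the start of \<open>P2\<close>, which adds one contact.\<close>

lemma interval_rot:
  "interval m j P' Q d \<Longrightarrow> rot m P P' \<Longrightarrow> descent_path m j P \<Longrightarrow> \<exists>d'>d. interval m j P Q d'"
proof (induction arbitrary: P rule: interval.induct)
  case Nil
  then show ?case by (auto simp: rot_def)
next
  case (Vert P' Q d)
  then obtain P0 where P0: "P = Vert # P0" "rot m P0 P'" using rot_Vert by blast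
  then obtain d' where "d' > d" "interval m m P0 Q d'" using Vert by auto
  then show ?case using interval.Vert P0 by blast
next
  case (Hor j P1 P2 Q1 d1 P3 Q2 d2)
  from Hor.prems show ?case
  proof (cases rule: rot_Suc_cases)
    case (left A A' B)
    then have e: "P1 = A'" "P2 @ P3 = B"
      using descent_path_prefix_unique[OF left(2) Hor.hyps(3)] by auto
    have "rot m (A @ P2) (P1 @ P2)" using rot_context[OF left(3), of "[]" P2] e by simp
    moreover have "descent_path m j (A @ P2)" using left Hor.hyps by (simp add: descent_path_append0)
    ultimately obtain d' where "d' > d1" "interval m j (A @ P2) Q1 d'" using Hor.IH(1) by blast
    then show ?thesis using interval.Hor[of m j A P2 Q1 d' P3 Q2 d2] Hor.hyps left e
      by (intro exI[of _ "d' + d2 + base_contacts m 0 P2"]) auto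
  next
    case (right A B B')
    then have e: "P1 = A" "P2 @ P3 = B'"
      using descent_path_prefix_unique[OF right(2) Hor.hyps(3)] by auto
    have "rot m B (P2 @ P3)" using right e by simp
    from rot_append_cases[OF this right(5) Hor.hyps(4)] show ?thesis
    proof (elim disjE exE conjE)
      fix P2' assume P2': "B = P2' @ P3" "rot m P2' P2" "descent_path m 0 P2'"
      have "rot m (P1 @ P2') (P1 @ P2)" using rot_context[OF P2'(2), of P1 "[]"] by simp
      moreover have "descent_path m j (P1 @ P2')" using Hor.hyps P2' by (simp add: descent_path_append0)
      ultimately obtain d' where "d' > d1" "interval m j (P1 @ P2') Q1 d'" using Hor.IH(1) by blast
      moreover have "base_contacts m 0 P2 \<le> base_contacts m 0 P2'"
        using rot_base_contacts[OF P2'(2,3)] .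
      ultimately show ?thesis
        using interval.Hor[of m j P1 P2' Q1 d' P3 Q2 d2] Hor.hyps P2' right(1) e
        by (intro exI[of _ "d' + d2 + base_contacts m 0 P2'"]) auto
    next
      fix P3' assume P3': "B = P2 @ P3'" "rot m P3' P3"
      then have "descent_path m 0 P3'" using right(5) Hor.hyps(4) by (simp add: descent_path_append0)
      then obtain d' where "d' > d2" "interval m 0 P3' Q2 d'" using Hor.IH(2) P3' by blast
      then show ?thesis using interval.Hor[of m j P1 P2 Q1 d1 P3' Q2 d'] Hor.hyps P3' right(1) e
        by (intro exI[of _ "d1 + d' + base_contacts m 0 P2"]) auto
    qed
  next
    case (mid A p B)
    have "descent_path m j (A @ p)" using mid by (simp add: descent_path_append0)
    then have e: "P1 = A @ p" "P2 @ P3 = B"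
      using descent_path_prefix_unique[of P1 "P2 @ P3" "A @ p" B] mid(2) Hor.hyps(3) by auto
    have "descent_path m 0 (p @ P2)" using mid Hor.hyps by (simp add: descent_path_append0)
    moreover have "base_contacts m 0 (p @ P2) = Suc (base_contacts m 0 P2)"
      using mid by (simp add: base_contacts_append)
    ultimately show ?thesis
      using interval.Hor[of m j A "p @ P2" Q1 d1 P3 Q2 d2] Hor.hyps mid e
      by (intro exI[of _ "d1 + d2 + Suc (base_contacts m 0 P2)"]) auto
  qed
qed

lemma rot_chain_interval:
  "(rot m ^^ k) P Q \<Longrightarrow> descent_path m j P \<Longrightarrow> \<exists>d\<ge>k. interval m j P Q d"
proof (induction k arbitrary: P)
  case 0
  then show ?case using interval_refl by auto
next
  case (Suc k)
  then obtain R where R: "rot m P R" "(rot m ^^ k) R Q" by (meson relpowp_Suc_D2)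
  then obtain d where "d \<ge> k" "interval m j R Q d" using Suc rot_descent_path by blast
  then obtain d' where "d' > d" "interval m j P Q d'" using interval_rot R Suc by blast
  then show ?case using \<open>d \<ge> k\<close> by (intro exI[of _ d']) auto
qed

section \<open>Statistics and distances of ballot paths\<close>

lemma level_0 [simp]: "level m w 0 = 0"
  by (simp add: level_def xpos_def ypos_def)

lemma level_Cons [simp]:
  "level m (Vert # w) (Suc k) = int m + level m w k"
  "level m (Hor # w) (Suc k) = level m w k - 1"
  by (simp_all add: level_def xpos_def ypos_def algebra_simps)

lemma level_add: "k \<le> length w \<Longrightarrow> level m w (k + r) = level m w k + level m (drop k w) r"
  by (simp add: level_def xpos_def ypos_def take_add algebra_simps)

lemma level_length: "level m w (length w) = int m * int (count_list w Vert) - int (count_list w Hor)"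
  by (simp add: level_def xpos_def ypos_def)

lemma all_le_Suc_iff: "(\<forall>k\<le>Suc n. P k) \<longleftrightarrow> P 0 \<and> (\<forall>k\<le>n. P (Suc k))"
  by (metis Suc_le_mono le0 not0_implies_Suc)

lemma descent_path_iff_level:
  "descent_path m h w \<longleftrightarrow>
     int h + level m w (length w) = 0 \<and> (\<forall>k\<le>length w. 0 \<le> int h + level m w k)"
proof (induction m h w rule: descent_path.induct)
  case (3 m w)
  have "\<exists>k\<le>length (Hor # w). level m (Hor # w) k < 0"
    by (rule exI[of _ "Suc 0"]) simp
  then show ?case by auto
qed (auto simp: all_le_Suc_iff algebra_simps)

lemma ballot_path_iff: "ballot_path m n w \<longleftrightarrow> descent_path m 0 w \<and> count_list w Vert = n"
proof -
  have "int m * int a - int b = 0 \<longleftrightarrow> b = a * m" for a b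
  proof -
    have "int m * int a - int b = 0 \<longleftrightarrow> int (a * m) = int b" by (simp add: mult.commute)
    then show ?thesis by (simp only: of_nat_eq_iff eq_commute)
  qed
  then show ?thesis
    unfolding ballot_path_def descent_path_iff_level level_length by auto
qed

lemma card_insert_0_Suc:
  "finite S \<Longrightarrow> card ((if b then {0} else {}) \<union> Suc ` S) = (if b then 1 else 0) + card S"
  by (auto simp: card_image card_insert_if)

lemma base_contacts_card:
  "descent_path m h w \<Longrightarrow> card {k. k < length w \<and> int h + level m w k = 0} = base_contacts m h w"
proof (induction m h w rule: descent_path.induct)
  case (2 m h w)
  have "{k. k < length (Vert # w) \<and> int h + level m (Vert # w) k = 0} =
     (if h = 0 then {0} else {}) \<union> Suc ` {k. k < length w \<and> int (h + m) + level m w k = 0}"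
    by (auto simp: image_iff less_Suc_eq_0_disj algebra_simps)
  moreover have "finite {k. k < length w \<and> int (h + m) + level m w k = 0}" by simp
  ultimately show ?case using 2 by (simp only: card_insert_0_Suc) simp
next
  case (4 m h w)
  have "{k. k < length (Hor # w) \<and> int (Suc h) + level m (Hor # w) k = 0} =
     Suc ` {k. k < length w \<and> int h + level m w k = 0}"
    by (auto simp: image_iff less_Suc_eq_0_disj algebra_simps)
  then show ?case using 4 by (simp add: card_image)
qed auto

lemma mcontacts_eq: "descent_path m 0 w \<Longrightarrow> mcontacts m w = base_contacts m 0 w"
  using base_contacts_card[of m 0 w] by (simp add: mcontacts_def)

lemma primitive_path_iff: "primitive_path m p \<longleftrightarrow> descent_path m 0 p \<and> base_contacts m 0 p = 1"
proof (cases "descent_path m 0 p \<and> p \<noteq> []")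
  case True
  define S where "S = {k. k < length p \<and> level m p k = 0}"
  have "0 \<in> S" using True by (simp add: S_def)
  have "card S = 1 \<longleftrightarrow> S = {0}"
  proof
    assume "card S = 1"
    then obtain x where "S = {x}" by (rule card_1_singletonE)
    then show "S = {0}" using \<open>0 \<in> S\<close> by simp
  qed simp
  moreover have "S = {0} \<longleftrightarrow> (\<forall>k. 0 < k \<and> k < length p \<longrightarrow> level m p k \<noteq> 0)"
  proof
    assume "S = {0}"
    then have "k \<notin> S" if "0 < k" for k using that by simp
    then show "\<forall>k. 0 < k \<and> k < length p \<longrightarrow> level m p k \<noteq> 0" by (simp add: S_def)
  next
    assume *: "\<forall>k. 0 < k \<and> k < length p \<longrightarrow> level m p k \<noteq> 0"
    have "k = 0" if "k \<in> S" for k using * that by (cases "k = 0") (auto simp: S_def)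
    then show "S = {0}" using \<open>0 \<in> S\<close> by blast
  qed
  moreover have "card S = base_contacts m 0 p"
    using base_contacts_card[of m 0 p] True by (simp add: S_def)
  ultimately show ?thesis
    using True by (simp add: primitive_path_def ballot_path_iff)
next
  case False
  then consider "\<not> descent_path m 0 p" | "p = []" by blast
  then show ?thesis by cases (simp_all add: primitive_path_def ballot_path_iff)
qed

text \<open>\<open>base_contacts\<close> counts the contacts followed by a vertical step. Since the
  path eventually goes below the line, there is exactly one more contact, where it leaves; hence the
  \<open>Suc\<close>.\<close>

lemma base_contacts_card_portion:
  "\<exists>r\<le>length v. int h + level m v r < 0 \<Longrightarrow>
     card {r. r \<le> length v \<and> int h + level m v r = 0 \<and> (\<forall>s\<le>r. 0 \<le> int h + level m v s)}
       = Suc (base_contacts m h v)"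
proof (induction v arbitrary: h)
  case (Cons x v)
  have fin: "finite {r. r \<le> length v \<and> Q r}" for Q by simp
  show ?case
  proof (cases x)
    case Vert
    obtain r where "r \<le> Suc (length v)" "int h + level m (Vert # v) r < 0"
      using Cons.prems Vert by auto
    then have "\<exists>r\<le>length v. int (h + m) + level m v r < 0"
      by (cases r) (auto simp: algebra_simps)
    note IH = Cons.IH[OF this]
    have "{r. r \<le> length (Vert # v) \<and> int h + level m (Vert # v) r = 0 \<and>
             (\<forall>s\<le>r. 0 \<le> int h + level m (Vert # v) s)} =
       (if h = 0 then {0} else {}) \<union>
        Suc ` {r. r \<le> length v \<and> int (h + m) + level m v r = 0 \<and> (\<forall>s\<le>r. 0 \<le> int (h + m) + level m v s)}"
      (is "?L = ?R")
    proof (rule set_eqI)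
      fix r show "r \<in> ?L \<longleftrightarrow> r \<in> ?R"
        by (cases r) (auto simp: all_le_Suc_iff image_iff algebra_simps)
    qed
    then show ?thesis
      unfolding Vert using IH by (simp only: card_insert_0_Suc[OF fin] base_contacts.simps)
  next
    case Hor
    show ?thesis
    proof (cases h)
      case 0
      have "{r. r \<le> length (Hor # v) \<and> int h + level m (Hor # v) r = 0 \<and>
             (\<forall>s\<le>r. 0 \<le> int h + level m (Hor # v) s)} = {0}" (is "?L = _")
      proof (rule set_eqI)
        fix r show "r \<in> ?L \<longleftrightarrow> r \<in> {0}"
        proof (cases r)
          case (Suc r')
          have "\<not> (\<forall>s\<le>r. 0 \<le> int h + level m (Hor # v) s)"
            using 0 Suc by (auto intro!: exI[of _ "Suc 0"])
          then show ?thesis using Suc by blast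
        qed (simp add: 0)
      qed
      then show ?thesis unfolding Hor by (simp add: 0)
    next
      case (Suc h')
      obtain r where "r \<le> Suc (length v)" "int h + level m (Hor # v) r < 0"
        using Cons.prems Hor by auto
      then have "\<exists>r\<le>length v. int h' + level m v r < 0"
        using Suc by (cases r) (auto simp: algebra_simps)
      note IH = Cons.IH[OF this]
      have "{r. r \<le> length (Hor # v) \<and> int h + level m (Hor # v) r = 0 \<and>
             (\<forall>s\<le>r. 0 \<le> int h + level m (Hor # v) s)} =
        Suc ` {r. r \<le> length v \<and> int h' + level m v r = 0 \<and> (\<forall>s\<le>r. 0 \<le> int h' + level m v s)}"
        (is "?L = ?R")
      proof (rule set_eqI)
        fix r show "r \<in> ?L \<longleftrightarrow> r \<in> ?R"
          by (cases r) (auto simp: all_le_Suc_iff image_iff algebra_simps Suc)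
      qed
      then show ?thesis
        unfolding Hor using IH by (simp add: Suc card_image)
    qed
  qed
qed auto

lemma step_contacts_eq:
  assumes w: "descent_path m 0 w" and k: "k < length w" "w ! k = Vert" and j: "1 \<le> j" "j \<le> m"
  shows "step_contacts m w k j = base_contacts m (m - j) (drop (Suc k) w)"
proof -
  let ?v = "drop (Suc k) w" and ?h = "m - j"
  \<comment> \<open>The good points form an initial segment of those after \<open>k\<close>, so they
    are exactly the points up to \<open>portion_end\<close>.\<close>
  define good where "good r \<longleftrightarrow> k < r \<and> r \<le> length w \<and>
     (\<forall>s. k < s \<and> s \<le> r \<longrightarrow> level m w k + int j \<le> level m w s)" for r
  have lev: "level m w (Suc k + r) = level m w k + int m + level m ?v r" for r
  proof -
    have "level m w (Suc k) = level m w k + int m"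
      using level_add[of k w m 1] Cons_nth_drop_Suc[OF k(1)] k level_Cons(1)[of m ?v 0] by simp
    then show ?thesis using level_add[of "Suc k" w m r] k by simp
  qed
  have fin: "finite {r. good r}" by (rule finite_subset[of _ "{..length w}"]) (auto simp: good_def)
  have "good (Suc k)"
  proof -
    have "level m w k + int j \<le> level m w s" if "k < s \<and> s \<le> Suc k" for s
    proof -
      have "s = Suc k" using that by simp
      then show ?thesis using lev[of 0] j by simp
    qed
    then show ?thesis unfolding good_def using k by simp
  qed
  have down: "good s" if "good r" "k < s" "s \<le> r" for r s
    using that unfolding good_def by (meson order_trans)
  have "good (Max {r. good r})" using Max_in[OF fin] \<open>good (Suc k)\<close> by blast
  have le_end: "k < s \<and> s \<le> Max {r. good r} \<longleftrightarrow> good s" for s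
  proof
    assume "k < s \<and> s \<le> Max {r. good r}"
    then show "good s" using down[OF \<open>good (Max {r. good r})\<close>] by blast
  next
    assume "good s"
    then show "k < s \<and> s \<le> Max {r. good r}" using Max_ge[OF fin, of s] unfolding good_def by blast
  qed
  have pe: "portion_end m w k j = Max {r. good r}"
    unfolding portion_end_def good_def ..
  let ?S = "{r. r \<le> length ?v \<and> int ?h + level m ?v r = 0 \<and> (\<forall>s\<le>r. 0 \<le> int ?h + level m ?v s)}"
  have "{s. k < s \<and> s \<le> portion_end m w k j \<and> level m w s = level m w k + int j} = (\<lambda>r. Suc k + r) ` ?S"
  proof (rule set_eqI)
    fix s
    show "s \<in> {s. k < s \<and> s \<le> portion_end m w k j \<and> level m w s = level m w k + int j} \<longleftrightarrow>
       s \<in> (\<lambda>r. Suc k + r) ` ?S"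
    proof (cases "k < s")
      case True
      then obtain r where "s = Suc (k + r)" using less_imp_Suc_add by blast
      then have r: "s = Suc k + r" by simp
      have h: "int ?h = int m - int j" using j by simp
      have "good s \<longleftrightarrow> r \<le> length ?v \<and> (\<forall>x\<le>r. 0 \<le> int ?h + level m ?v x)"
      proof -
        have "(\<forall>x. k < x \<and> x \<le> s \<longrightarrow> level m w k + int j \<le> level m w x) \<longleftrightarrow>
            (\<forall>x\<le>r. level m w k + int j \<le> level m w (Suc k + x))"
        proof safe
          fix x assume "\<forall>x\<le>r. level m w k + int j \<le> level m w (Suc k + x)" "k < x" "x \<le> s"
          moreover from \<open>k < x\<close> obtain y where "x = Suc (k + y)" using less_imp_Suc_add by blast
          ultimately show "level m w k + int j \<le> level m w x"
            by (simp add: r)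
        next
          fix x assume *: "\<forall>x. k < x \<and> x \<le> s \<longrightarrow> level m w k + int j \<le> level m w x" and "x \<le> r"
          then show "level m w k + int j \<le> level m w (Suc k + x)"
            using spec[OF *, of "Suc k + x"] by (simp add: r)
        qed
        also have "\<dots> \<longleftrightarrow> (\<forall>x\<le>r. 0 \<le> int ?h + level m ?v x)"
          unfolding lev h by (simp add: algebra_simps)
        finally have e: "(\<forall>x. k < x \<and> x \<le> s \<longrightarrow> level m w k + int j \<le> level m w x) \<longleftrightarrow>
            (\<forall>x\<le>r. 0 \<le> int ?h + level m ?v x)" .
        have "s \<le> length w \<longleftrightarrow> r \<le> length ?v" using k r by auto
        then show ?thesis unfolding good_def e using True by simp
      qed
      moreover have "level m w s = level m w k + int j \<longleftrightarrow> int ?h + level m ?v r = 0"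
        unfolding r lev h by linarith
      ultimately have "s \<in> {s. k < s \<and> s \<le> portion_end m w k j \<and> level m w s = level m w k + int j}
         \<longleftrightarrow> r \<in> ?S"
        using le_end[of s] unfolding pe mem_Collect_eq by blast
      moreover have "s \<in> (\<lambda>r. Suc k + r) ` ?S \<longleftrightarrow> r \<in> ?S"
        unfolding r by (rule inj_image_mem_iff) (simp add: inj_def)
      ultimately show ?thesis by (simp only:)
    next
      case False
      then have "s \<notin> (\<lambda>r. Suc k + r) ` X" for X by auto
      then show ?thesis using False by blast
    qed
  qed
  then have "card {s. k < s \<and> s \<le> portion_end m w k j \<and> level m w s = level m w k + int j} = card ?S"
    by (simp add: card_image inj_on_def)
  \<comment> \<open>The line has level at least \<open>j\<close>, which is positive, while the path
    ends at level 0: it does go below the line.\<close>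
  also have "\<dots> = Suc (base_contacts m ?h ?v)"
  proof (rule base_contacts_card_portion, intro exI conjI)
    show "length ?v \<le> length ?v" ..
    have "Suc k + length ?v = length w" using k by simp
    then have "level m w (Suc k + length ?v) = 0"
      using w by (simp only: descent_path_iff_level) simp
    moreover have "0 \<le> level m w k" using w k by (simp add: descent_path_iff_level)
    ultimately show "int ?h + level m ?v (length ?v) < 0"
      using lev[of "length ?v"] j by simp
  qed
  finally show ?thesis by (simp add: step_contacts_def)
qed

lemma step_positions_Cons:
  "step_positions s (x # w) = (if x = s then [0] else []) @ map Suc (step_positions s w)"
proof -
  have "[0..<length (x # w)] = 0 # map Suc [0..<length w]"
    by (simp add: upt_conv_Cons map_Suc_upt del: upt_Suc)
  then show ?thesis by (simp add: step_positions_def filter_map o_def)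
qed

lemma vert_contacts_eq:
  "vert_contacts m w = concat (map (\<lambda>k. map (\<lambda>j. base_contacts m (m - j) (drop (Suc k) w)) [1..<Suc m])
     (step_positions Vert w))"
proof (induction w)
  case Nil
  then show ?case by (simp add: step_positions_def)
next
  case (Cons x w)
  then show ?case by (cases x) (simp_all add: step_positions_Cons o_def del: upt_Suc)
qed

lemma contact_vector_eq:
  assumes "descent_path m 0 w"
  shows "contact_vector m w = butlast (base_contacts m 0 w # vert_contacts m w)"
proof -
  have "concat (map (\<lambda>k. map (step_contacts m w k) [1..<Suc m]) (step_positions Vert w)) = vert_contacts m w"
    unfolding vert_contacts_eq
    by (intro arg_cong[where f = concat] map_cong refl step_contacts_eq[OF assms])
      (auto simp: step_positions_def)
  then show ?thesis by (simp add: contact_vector_def mcontacts_eq[OF assms])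
qed

lemma runs_eq: "runs w = mrises w # map (step_rises w) (step_positions Hor w)"
proof (induction w)
  case Nil
  then show ?case by (simp add: mrises_def step_positions_def)
next
  case (Cons x w)
  have "map (step_rises (x # w)) (map Suc ks) = map (step_rises w) ks" for ks
    by (simp add: step_rises_def)
  then show ?case using Cons
    by (cases x) (simp_all add: step_positions_Cons step_rises_def mrises_def)
qed

lemma rise_vector_eq: "rise_vector w = butlast (runs w)"
  by (simp add: rise_vector_def runs_eq)

lemma mrises_eq: "mrises w = hd (runs w)"
  by (simp add: runs_eq)

text \<open>A path ending on the base line cannot end with a vertical step, so the entry dropped
  from the rise vector is 0.\<close>

lemma last_runs: "1 \<le> m \<Longrightarrow> descent_path m h w \<Longrightarrow> last (runs w) = 0"
proof (cases w rule: rev_cases)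
  case (snoc w' s)
  have *: "\<not> descent_path m h (w' @ [Vert])" if "0 < m" for h w'
    using that by (induction m h w' rule: descent_path.induct) auto
  show "1 \<le> m \<Longrightarrow> descent_path m h w \<Longrightarrow> last (runs w) = 0" 
    using snoc runs_append_Hor[of w' "[]"] * by (cases s) auto
qed simp

text \<open>No contact is counted after the last vertical step, so the entry dropped from the
  contact vector is 0.\<close>

lemma last_vert_contacts:
  assumes "1 \<le> m" "vert_contacts m w \<noteq> []"
  shows "last (vert_contacts m w) = 0"
proof -
  have no: "vert_contacts m w = [] \<Longrightarrow> base_contacts m h w = 0" for h w
    using assms(1) by (induction m h w rule: base_contacts.induct) auto
  show ?thesis
    using assms(2)
  proof (induction w)
    case (Cons x w)
    show ?case
    proof (cases x)
      case Vert
      show ?thesis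
      proof (cases "vert_contacts m w = []")
        case True
        then show ?thesis using assms(1) no[OF True] Vert by (simp add: last_map)
      next
        case False
        then show ?thesis using Cons Vert by (simp add: last_append)
      qed
    qed (use Cons in simp)
  qed simp
qed

lemma prod_list_butlast:
  "xs \<noteq> [] \<Longrightarrow> last xs = 0 \<Longrightarrow>
    prod_list (map X xs) = prod_list (map X (butlast xs)) * (X (0::nat) :: 'a::comm_semiring_1)"
  by (induction xs rule: rev_induct) auto

lemma mContactMon_eq:
  assumes "1 \<le> m" "descent_path m 0 w"
  shows "mContactMon m w X * X 0 = X (base_contacts m 0 w) * prod_list (map X (vert_contacts m w))"
proof -
  let ?l = "base_contacts m 0 w # vert_contacts m w"
  have "last ?l = 0"
  proof (cases "vert_contacts m w = []")
    case True
    then have "w = []" using assms by (cases w; cases "hd w") auto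
    then show ?thesis by simp
  next
    case False
    then show ?thesis using last_vert_contacts assms by simp
  qed
  then show ?thesis
    using prod_list_butlast[of ?l X] by (simp add: mContactMon_def contact_vector_eq[OF assms(2)])
qed

lemma mRiseMon_eq:
  assumes "1 \<le> m" "descent_path m 0 w"
  shows "mRiseMon w Y * Y 0 = Y (hd (runs w)) * prod_list (map Y (tl (runs w)))"
proof -
  have "mRiseMon w Y * Y 0 = prod_list (map Y (runs w))"
    using prod_list_butlast[of "runs w" Y] last_runs[OF assms] by (simp add: mRiseMon_def rise_vector_eq)
  then show ?thesis by (cases "runs w") simp_all
qed

section \<open>Tamari order, covers and longest chains in terms of \<open>interval\<close>\<close>

lemma rotation_iff: "rotation m n P Q \<longleftrightarrow> rot m P Q \<and> descent_path m 0 P \<and> count_list P Vert = n"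
proof -
  have "rotation m n P Q \<longleftrightarrow> ballot_path m n P \<and> ballot_path m n Q \<and> rot m P Q"
    by (simp only: rotation_def primitive_path_iff rot_def conj_assoc)
  then show ?thesis
    unfolding ballot_path_iff using rot_descent_path[of m P Q 0] rot_count[of m P Q Vert] by metis
qed

lemma rotation_chain_iff:
  "descent_path m 0 P \<Longrightarrow> count_list P Vert = n \<Longrightarrow> (rotation m n ^^ k) P Q \<longleftrightarrow> (rot m ^^ k) P Q"
proof (induction k arbitrary: P)
  case (Suc k)
  have "(rotation m n ^^ k) R Q \<longleftrightarrow> (rot m ^^ k) R Q" if "rot m P R" for R
    using Suc.IH[of R] Suc.prems rot_descent_path[OF that] rot_count[OF that, of Vert] by auto
  then show ?case
    using Suc.prems rotation_iff[of m n P] relpowp_Suc_D2[of k "rotation m n" P Q]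
      relpowp_Suc_D2[of k "rot m" P Q] relpowp_Suc_I2[of "rotation m n" P _ k Q]
      relpowp_Suc_I2[of "rot m" P _ k Q] by blast
qed simp

lemma tamari_le_iff: "tamari_le m n P Q \<longleftrightarrow> count_list Q Vert = n \<and> (\<exists>d. interval m 0 P Q d)"
proof
  assume *: "tamari_le m n P Q"
  then obtain k where "(rotation m n ^^ k) P Q" by (auto simp: tamari_le_def rtranclp_power)
  then show "count_list Q Vert = n \<and> (\<exists>d. interval m 0 P Q d)"
    using * rot_chain_interval[of k m P Q 0]
    by (auto simp: tamari_le_def ballot_path_iff rotation_chain_iff)
next
  assume "count_list Q Vert = n \<and> (\<exists>d. interval m 0 P Q d)"
  then obtain d where "interval m 0 P Q d" and n: "count_list Q Vert = n" by blast
  then show "tamari_le m n P Q"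
    using interval_descent_path[of m 0 P Q d] interval_rot_chain[of m 0 P Q d]
    by (auto simp: tamari_le_def ballot_path_iff rtranclp_power rotation_chain_iff)
qed

lemma tamari_covers_rotation: "tamari_covers m n P Q \<Longrightarrow> rotation m n P Q"
proof -
  assume c: "tamari_covers m n P Q"
  then have le: "tamari_le m n P Q" "P \<noteq> Q" by (auto simp: tamari_covers_def tamari_less_def)
  then obtain R where R: "rotation m n P R" "(rotation m n)\<^sup>*\<^sup>* R Q"
    by (metis converse_rtranclpE tamari_le_def)
  have "R \<noteq> P" using vh_pairs_rotation[OF R(1)] by auto
  have b: "ballot_path m n P" "ballot_path m n R" "ballot_path m n Q"
    using R(1) le(1) by (simp_all add: rotation_def tamari_le_def)
  have "tamari_less m n P R"
    using R(1) b \<open>R \<noteq> P\<close> by (auto simp: tamari_less_def tamari_le_def)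
  then have "\<not> tamari_less m n R Q" using c by (auto simp: tamari_covers_def)
  then have "R = Q" using R(2) b by (simp add: tamari_less_def tamari_le_def)
  then show ?thesis using R by simp
qed

text \<open>A rotation is a strict step in the order and so refines to a chain of at least one
  cover.\<close>

lemma rotation_chain_covers:
  "(rotation m n ^^ k) P Q \<Longrightarrow> \<exists>l\<ge>k. (tamari_covers m n ^^ l) P Q"
proof (induction k arbitrary: Q)
  case 0
  then show ?case by (intro exI[of _ 0]) auto
next
  case (Suc k)
  then obtain R where R: "(rotation m n ^^ k) P R" "rotation m n R Q" by auto
  then obtain l where l: "l \<ge> k" "(tamari_covers m n ^^ l) P R" using Suc.IH by blast
  have "tamari_le m n R Q"
    using R(2) r_into_rtranclp[of "rotation m n" R Q] unfolding tamari_le_def rotation_def by blast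
  then obtain l' where l': "(tamari_covers m n ^^ l') R Q" using chain_lengths_nonempty by blast
  have "l' \<noteq> 0" using l' vh_pairs_rotation[OF R(2)] by (cases l') auto
  then have "Suc k \<le> l + l'" using l by simp
  moreover have "(tamari_covers m n ^^ (l + l')) P Q" using l l' by (auto simp: relpowp_add)
  ultimately show ?case by blast
qed

text \<open>Covers are rotations, so no chain of covers is longer than \<open>d\<close>; a chain of
  \<open>d\<close> rotations refines to at least \<open>d\<close> covers, so \<open>d\<close> is
  attained.\<close>

lemma tamari_dist_eq:
  assumes "interval m 0 P Q d" "count_list Q Vert = n"
  shows "tamari_dist m n (P, Q) = d"
proof -
  let ?K = "{k. (tamari_covers m n ^^ k) P Q}"
  have P: "descent_path m 0 P" "count_list P Vert = n"
    using interval_descent_path[OF assms(1)] assms(2) by auto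
  have le: "k \<le> d" if "k \<in> ?K" for k
  proof -
    have "(rotation m n ^^ k) P Q"
      using that relpowp_mono[of "tamari_covers m n" "rotation m n" k] tamari_covers_rotation by blast
    then obtain d' where "d' \<ge> k" "interval m 0 P Q d'"
      using rot_chain_interval rotation_chain_iff P by metis
    then show ?thesis using interval_dist_unique assms(1) by blast
  qed
  obtain l where l: "l \<ge> d" "l \<in> ?K"
    using rotation_chain_covers[of d m n P Q] interval_rot_chain[OF assms(1)] rotation_chain_iff[OF P] by auto
  then have "d \<in> ?K" using le by (metis le_antisym)
  then show ?thesis
    unfolding tamari_dist_def fst_conv snd_conv using finite_chain_lengths le by (intro Max_eqI) auto
qed

section \<open>Generating functions of intervals\<close>

definition interval_set :: "nat \<Rightarrow> nat \<Rightarrow> nat \<Rightarrow> (path \<times> path \<times> nat) set" where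
  "interval_set m j n = {(P, Q, d). interval m j P Q d \<and> count_list Q Vert = n}"

text \<open>For a path starting at height \<open>j\<close>, the first part lists the contacts with
  the lines at heights \<open>j\<close> down to 1. The base line is left out: its contacts are the
  exponent of \<open>x\<close>.\<close>

definition contact_labels :: "nat \<Rightarrow> nat \<Rightarrow> path \<Rightarrow> nat list" where
  "contact_labels m j P = map (\<lambda>h. base_contacts m h P) [0..<j] @ vert_contacts m P"

definition weight ::
    "nat \<Rightarrow> (nat \<Rightarrow> 'a::comm_ring_1) \<Rightarrow> (nat \<Rightarrow> 'a) \<Rightarrow> 'a \<Rightarrow> nat \<Rightarrow> path \<times> path \<times> nat \<Rightarrow> 'a" where
  "weight m X Y q j = (\<lambda>(P, Q, d). prod_list (map X (contact_labels m j P)) *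
     prod_list (map Y (tl (runs Q))) * q ^ d)"

abbreviation lower_contacts :: "nat \<Rightarrow> nat \<Rightarrow> path \<times> path \<times> nat \<Rightarrow> nat" where
  "lower_contacts m j I \<equiv> base_contacts m j (fst I)"

abbreviation upper_rise :: "path \<times> path \<times> nat \<Rightarrow> nat" where
  "upper_rise I \<equiv> hd (runs (fst (snd I)))"

text \<open>The coefficient of \<open>x^i\<close> in \<open>A^j f_k\<close>: each application of the
  operator raises the starting height by one.\<close>

definition interval_gf ::
    "nat \<Rightarrow> (nat \<Rightarrow> 'a::comm_ring_1) \<Rightarrow> (nat \<Rightarrow> 'a) \<Rightarrow> 'a \<Rightarrow> nat \<Rightarrow> nat \<Rightarrow> nat \<Rightarrow> 'a fps" where
  "interval_gf m X Y q j k i = Abs_fps (\<lambda>n. \<Sum>I\<in>interval_set m j n.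
     if lower_contacts m j I = i \<and> upper_rise I = k then weight m X Y q j I else 0)"

lemma finite_interval_set [simp]: "finite (interval_set m j n)"
proof -
  have *: "(UNIV :: step set) = {Vert, Hor}"
    using step.exhaust by auto
  let ?W = "{w :: path. set w \<subseteq> UNIV \<and> length w = n + (j + m * n)}"
  have W: "finite ?W"
    by (rule finite_lists_length_eq) (simp add: *)
  have "(\<lambda>(P, Q, d). (P, Q)) ` interval_set m j n \<subseteq> ?W \<times> ?W"
    by (auto simp: interval_set_def length_count descent_path_length dest: interval_descent_path)
  then have "finite ((\<lambda>(P, Q, d). (P, Q)) ` interval_set m j n)"
    using W by (meson finite_SigmaI finite_subset)
  moreover have "inj_on (\<lambda>(P, Q, d). (P, Q)) (interval_set m j n)"
    by (auto simp: inj_on_def interval_set_def dest: interval_dist_unique)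
  ultimately show ?thesis by (rule finite_imageD)
qed

lemma interval_set_0_0: "interval_set m 0 0 = {([], [], 0)}"
proof -
  have "P = [] \<and> Q = [] \<and> d = 0" if "interval m 0 P Q d" "count_list Q Vert = 0" for P Q d
    using interval_0_cases[OF that(1)] that(2) by auto
  then show ?thesis by (auto simp: interval_set_def intro: interval.Nil)
qed

lemma interval_set_0_Suc:
  "interval_set m 0 (Suc n) = (\<lambda>(P, Q, d). (Vert # P, Vert # Q, d)) ` interval_set m m n" (is "?L = ?R")
proof
  show "?R \<subseteq> ?L" by (auto simp: interval_set_def intro: interval.Vert)
  have "(P, Q, d) \<in> ?R" if "interval m 0 P Q d" "count_list Q Vert = Suc n" for P Q d
    using interval_0_cases[OF that(1)] that(2) by (force simp: interval_set_def)
  then show "?L \<subseteq> ?R" by (auto simp: interval_set_def)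
qed

lemma interval_gf_0_0: "interval_gf m X Y q 0 0 = (\<lambda>i. if i = 0 then 1 else 0)"
proof (rule ext, rule fps_ext)
  fix i n
  show "interval_gf m X Y q 0 0 i $ n = (if i = 0 then 1 else 0) $ n"
  proof (cases n)
    case 0
    then show ?thesis
      by (simp add: interval_gf_def interval_set_0_0 weight_def contact_labels_def)
  next
    case (Suc n')
    have "upper_rise I \<noteq> 0" if "I \<in> interval_set m 0 n" for I
      using that by (auto simp: Suc interval_set_0_Suc)
    then have "interval_gf m X Y q 0 0 i $ n = 0"
      unfolding interval_gf_def fps_nth_Abs_fps by (intro sum.neutral ballI if_not_P) blast
    then show ?thesis by (simp add: Suc)
  qed
qed

text \<open>The labels of the removed step are the line labels of the remaining path, started at
  height \<open>m\<close>, in reverse order.\<close>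

lemma prod_list_contact_labels_Vert:
  "prod_list (map X (contact_labels m 0 (Vert # P))) =
     (prod_list (map X (contact_labels m m P)) :: 'a::comm_ring_1)"
proof -
  have r: "map (\<lambda>j. m - j) [1..<Suc m] = rev [0..<m]"
    by (rule nth_equalityI) (auto simp: rev_nth simp del: upt_Suc)
  have "map (\<lambda>j. base_contacts m (m - j) P) [1..<Suc m] =
      map (\<lambda>h. base_contacts m h P) (map (\<lambda>j. m - j) [1..<Suc m])"
    by (simp only: map_map o_def)
  also have "\<dots> = rev (map (\<lambda>h. base_contacts m h P) [0..<m])"
    by (simp only: r rev_map)
  finally have "map (\<lambda>j. base_contacts m (m - j) P) [1..<Suc m] =
      rev (map (\<lambda>h. base_contacts m h P) [0..<m])" .
  then have "map X (map (\<lambda>j. base_contacts m (m - j) P) [1..<Suc m]) =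
      rev (map X (map (\<lambda>h. base_contacts m h P) [0..<m]))"
    by (simp only: rev_map)
  then show ?thesis
    by (simp add: contact_labels_def prod_list.rev del: upt_Suc map_map)
qed

text \<open>Removing the first vertical step from both paths lowers size, rise and contacts by one
  each.\<close>

lemma interval_gf_0_Suc:
  "interval_gf m X Y q 0 (Suc k) = (\<lambda>i. fps_X * shift_seq (interval_gf m X Y q m k) i)"
proof (rule ext, rule fps_ext)
  fix i n
  show "interval_gf m X Y q 0 (Suc k) i $ n = (fps_X * shift_seq (interval_gf m X Y q m k) i) $ n"
  proof (cases n)
    case 0
    then show ?thesis by (simp add: interval_gf_def interval_set_0_0)
  next
    case (Suc n')
    let ?h = "\<lambda>(P, Q, d :: nat). (Vert # P, Vert # Q, d)"
    have inj: "inj_on ?h (interval_set m m n')" by (auto simp: inj_on_def)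
    have "interval_gf m X Y q 0 (Suc k) i $ n = (\<Sum>I\<in>interval_set m m n'.
       if Suc (lower_contacts m m I) = i \<and> upper_rise I = k then weight m X Y q m I else 0)"
      unfolding interval_gf_def fps_nth_Abs_fps Suc interval_set_0_Suc sum.reindex[OF inj]
      by (rule sum.cong) (auto simp: weight_def prod_list_contact_labels_Vert)
    also have "\<dots> = (fps_X * shift_seq (interval_gf m X Y q m k) i) $ n"
      by (cases i) (auto simp: shift_seq_def interval_gf_def Suc)
    finally show ?thesis .
  qed
qed

section \<open>Cutting an interval where its upper path first reaches the base line\<close>

definition contact_split :: "nat \<Rightarrow> nat \<Rightarrow> path \<Rightarrow> nat \<Rightarrow> path \<times> path" where
  "contact_split m j w a = (SOME (u, v). w = u @ v \<and> descent_path m j u \<and> descent_path m 0 v \<and>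
     base_contacts m j u = a)"

lemma contact_split:
  assumes "descent_path m j w" "a \<le> base_contacts m j w" "contact_split m j w a = (u, v)"
  shows "w = u @ v \<and> descent_path m j u \<and> descent_path m 0 v \<and> base_contacts m j u = a"
proof -
  let ?Q = "\<lambda>(u, v). w = u @ v \<and> descent_path m j u \<and> descent_path m 0 v \<and> base_contacts m j u = a"
  have "\<exists>x. ?Q x"
    using descent_path_contact_split[OF assms(1,2)] unfolding split_paired_Ex prod.case .
  then have "?Q (contact_split m j w a)"
    unfolding contact_split_def by (rule someI_ex)
  then show ?thesis unfolding assms(3) prod.case .
qed

lemma contact_split_append:
  assumes "descent_path m j u" "descent_path m 0 v"
  shows "contact_split m j (u @ v) (base_contacts m j u) = (u, v)"
proof -
  obtain u' v' where uv: "contact_split m j (u @ v) (base_contacts m j u) = (u', v')" by fastforce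
  have "descent_path m j (u @ v)" "base_contacts m j u \<le> base_contacts m j (u @ v)"
    using assms by (simp_all add: descent_path_append0 base_contacts_append)
  from contact_split[OF this uv] have *: "u @ v = u' @ v'" "descent_path m j u'"
      "base_contacts m j u' = base_contacts m j u" by blast+
  show ?thesis
    using prefix_contacts_unique[OF *(1) assms(1) *(2) *(3)[symmetric]] uv by blast
qed

text \<open>Besides the two smaller intervals there is the datum \<open>a\<close>: it selects the
  contact at which the lower path \<open>P\<close> is cut and the step \<open>Hor\<close>
  inserted.\<close>

definition glue ::
    "nat \<Rightarrow> nat \<Rightarrow> nat \<times> (path \<times> path \<times> nat) \<times> (path \<times> path \<times> nat) \<times> nat \<Rightarrow> path \<times> path \<times> nat" where
  "glue m j = (\<lambda>(n', (P3, Q2, d2), (P, Q1, d1), a). case contact_split m j P a of (P1, P2) \<Rightarrow>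
     (P1 @ Hor # P2 @ P3, Q1 @ Hor # Q2, d1 + d2 + base_contacts m 0 P2))"

definition glue_domain ::
    "nat \<Rightarrow> nat \<Rightarrow> nat \<Rightarrow> (nat \<times> (path \<times> path \<times> nat) \<times> (path \<times> path \<times> nat) \<times> nat) set" where
  "glue_domain m j n = (SIGMA n':{..n}. SIGMA I:interval_set m 0 n'. SIGMA J:interval_set m j (n - n').
     {..lower_contacts m j J})"

lemma bij_betw_glue: "bij_betw (glue m j) (glue_domain m j n) (interval_set m (Suc j) n)"
proof (rule bij_betw_imageI)
  let ?D = "glue_domain m j n"
  have D: "\<exists>P1 P2. contact_split m j P a = (P1, P2) \<and> P = P1 @ P2 \<and> descent_path m j P1 \<and>
      descent_path m 0 P2 \<and> base_contacts m j P1 = a \<and>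
      interval m j (P1 @ P2) Q1 d1 \<and> interval m 0 P3 Q2 d2 \<and> n' \<le> n \<and>
      count_list Q2 Vert = n' \<and> count_list Q1 Vert = n - n'"
    if "(n', (P3, Q2, d2), (P, Q1, d1), a) \<in> ?D" for n' P3 Q2 d2 P Q1 d1 a
  proof -
    obtain P1 P2 where s: "contact_split m j P a = (P1, P2)" by fastforce
    have I: "interval m j P Q1 d1" "a \<le> base_contacts m j P"
      using that by (auto simp: glue_domain_def interval_set_def)
    from contact_split[OF conjunct1[OF interval_descent_path[OF I(1)]] I(2) s] s I that
    show ?thesis by (auto simp: glue_domain_def interval_set_def)
  qed
  show "inj_on (glue m j) ?D"
  proof (rule inj_onI)
    fix x y assume xy: "x \<in> ?D" "y \<in> ?D" "glue m j x = glue m j y"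
    obtain n' P3 Q2 d2 P Q1 d1 a where x: "x = (n', (P3, Q2, d2), (P, Q1, d1), a)"
      by (metis prod.exhaust)
    obtain n'' P3' Q2' d2' P' Q1' d1' a' where y: "y = (n'', (P3', Q2', d2'), (P', Q1', d1'), a')"
      by (metis prod.exhaust)
    note 1 = xy(1)[unfolded x] and 2 = xy(2)[unfolded y] and e = xy(3)[unfolded x y]
    from D[OF 1] obtain P1 P2 where 1: "contact_split m j P a = (P1, P2)" "P = P1 @ P2" "descent_path m j P1"
      "base_contacts m j P1 = a" "interval m j (P1 @ P2) Q1 d1" "interval m 0 P3 Q2 d2"
      "count_list Q2 Vert = n'" by blast
    from D[OF 2] obtain P1' P2' where 2: "contact_split m j P' a' = (P1', P2')" "P' = P1' @ P2'" "descent_path m j P1'"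
      "base_contacts m j P1' = a'" "interval m j (P1' @ P2') Q1' d1'" "interval m 0 P3' Q2' d2'"
      "count_list Q2' Vert = n''" by blast
    have "P1 @ Hor # P2 @ P3 = P1' @ Hor # P2' @ P3'" "Q1 @ Hor # Q2 = Q1' @ Hor # Q2'"
      using e by (simp_all add: glue_def 1(1) 2(1))
    from interval_Hor_unique[OF this 1(3) 2(3) 1(5) 2(5) 1(6) 2(6)]
    have eq: "P1 = P1'" "P2 = P2'" "P3 = P3'" "Q1 = Q1'" "Q2 = Q2'" by auto
    moreover have "d1 = d1'" using 1(5) 2(5) eq interval_dist_unique by blast
    moreover have "d2 = d2'" using 1(6) 2(6) eq interval_dist_unique by blast
    ultimately show "x = y"
      using 1(2,4,7) 2(2,4,7) by (simp add: x y)
  qed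
  show "glue m j ` ?D = interval_set m (Suc j) n"
  proof
    have "glue m j (n', (P3, Q2, d2), (P, Q1, d1), a) \<in> interval_set m (Suc j) n"
      if dom: "(n', (P3, Q2, d2), (P, Q1, d1), a) \<in> ?D" for n' P3 Q2 d2 P Q1 d1 a
    proof -
      from D[OF dom] obtain P1 P2 where 1: "contact_split m j P a = (P1, P2)" "descent_path m j P1" "descent_path m 0 P2"
        "interval m j (P1 @ P2) Q1 d1" "interval m 0 P3 Q2 d2"
        "n' \<le> n" "count_list Q2 Vert = n'" "count_list Q1 Vert = n - n'" by blast
      show ?thesis using interval.Hor[OF 1(4,5,2,3)] 1(6-8) by (simp add: glue_def 1(1) interval_set_def)
    qed
    then show "glue m j ` ?D \<subseteq> interval_set m (Suc j) n" by auto
    have "(P, Q, d) \<in> glue m j ` ?D" if I: "interval m (Suc j) P Q d" and n: "count_list Q Vert = n" for P Q d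
    proof -
      from I obtain P1 P2 P3 Q1 Q2 d1 d2 where 1: "P = P1 @ Hor # P2 @ P3" "Q = Q1 @ Hor # Q2"
        "d = d1 + d2 + base_contacts m 0 P2" "interval m j (P1 @ P2) Q1 d1" "interval m 0 P3 Q2 d2"
        "descent_path m j P1" "descent_path m 0 P2"
        by (rule interval_Suc_cases)
      let ?x = "(count_list Q2 Vert, (P3, Q2, d2), (P1 @ P2, Q1, d1), base_contacts m j P1)"
      have "?x \<in> ?D"
        using 1 n by (simp add: glue_domain_def interval_set_def base_contacts_append)
      moreover have "glue m j ?x = (P, Q, d)"
        by (simp add: glue_def contact_split_append[OF 1(6,7)] 1(1-3))
      ultimately show ?thesis by (metis image_eqI)
    qed
    then show "interval_set m (Suc j) n \<subseteq> glue m j ` ?D" by (auto simp: interval_set_def)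
  qed
qed

text \<open>\<open>P1\<close> ends one level above the new base line, so its \<open>a\<close>
  contacts become the label \<open>X a\<close>. The contacts of \<open>P2\<close> and of the lower
  path of \<open>I\<close> now lie on the base line, and those of \<open>P2\<close> also count
  towards the distance. The initial rise of \<open>I\<close> becomes an inner rise.\<close>

lemma glue_stats:
  assumes "I \<in> interval_set m 0 n'" "J \<in> interval_set m j n''" "a \<le> lower_contacts m j J"
  shows "lower_contacts m (Suc j) (glue m j (n', I, J, a)) = lower_contacts m 0 I + (lower_contacts m j J - a)"
    and "upper_rise (glue m j (n', I, J, a)) = upper_rise J"
    and "weight m X Y q (Suc j) (glue m j (n', I, J, a)) =
      (Y (upper_rise I) * weight m X Y q 0 I) *
      (q ^ (lower_contacts m j J - a) * (X a * weight m X Y q j J))"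
proof -
  obtain P3 Q2 d2 where I: "I = (P3, Q2, d2)" by (cases I) auto
  obtain P Q1 d1 where J: "J = (P, Q1, d1)" by (cases J) auto
  obtain P1 P2 where s: "contact_split m j P a = (P1, P2)" by fastforce
  have "descent_path m j P" "a \<le> base_contacts m j P"
    using assms interval_descent_path[of m j P] by (auto simp: J interval_set_def)
  from contact_split[OF this s] have P: "P = P1 @ P2" and D: "descent_path m j P1" "descent_path m 0 P2"
    and a: "base_contacts m j P1 = a" by auto
  have g: "glue m j (n', I, J, a) = (P1 @ Hor # P2 @ P3, Q1 @ Hor # Q2, d1 + d2 + base_contacts m 0 P2)"
    by (simp add: glue_def I J s)
  have cP2: "base_contacts m 0 P2 = lower_contacts m j J - a"
    by (simp add: J P base_contacts_append[OF D(1)] a)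
  have "base_contacts m (Suc j) (P1 @ Hor # P2 @ P3) = base_contacts m 0 (P2 @ P3)"
    using base_contacts_append_above[OF D(1), of 1] by simp
  then show "lower_contacts m (Suc j) (glue m j (n', I, J, a)) = lower_contacts m 0 I + (lower_contacts m j J - a)"
    unfolding g cP2[symmetric] by (simp add: I base_contacts_append[OF D(2)])
  show "upper_rise (glue m j (n', I, J, a)) = upper_rise J"
    unfolding g by (simp add: J runs_append_Hor)
  have "map (\<lambda>h. base_contacts m h (P1 @ Hor # P2 @ P3)) [0..<j] = map (\<lambda>h. base_contacts m h P) [0..<j]"
    by (rule map_cong) (simp_all add: P base_contacts_append_below[OF D(1)])
  then have L: "contact_labels m (Suc j) (P1 @ Hor # P2 @ P3) =
      map (\<lambda>h. base_contacts m h P) [0..<j] @ [a] @ vert_contacts m P1 @ vert_contacts m P2 @ vert_contacts m P3"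
    using base_contacts_append_Hor[OF D(1), of "P2 @ P3"] a
    by (simp add: contact_labels_def vert_contacts_append[OF D(1)] vert_contacts_append[OF D(2)])
  have "prod_list (map X (contact_labels m (Suc j) (P1 @ Hor # P2 @ P3))) =
      X a * prod_list (map X (contact_labels m j P)) * prod_list (map X (contact_labels m 0 P3))"
    unfolding L by (simp add: contact_labels_def P vert_contacts_append[OF D(1)] ac_simps)
  moreover have "prod_list (map Y (tl (runs (Q1 @ Hor # Q2)))) =
      prod_list (map Y (tl (runs Q1))) * (Y (hd (runs Q2)) * prod_list (map Y (tl (runs Q2))))"
    by (cases "runs Q2") (simp_all add: runs_append_Hor)
  ultimately show "weight m X Y q (Suc j) (glue m j (n', I, J, a)) =
      (Y (upper_rise I) * weight m X Y q 0 I) *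
      (q ^ (lower_contacts m j J - a) * (X a * weight m X Y q j J))"
    unfolding g cP2[symmetric] by (simp add: weight_def I J power_add ac_simps)
qed

text \<open>Under the bijection \<open>glue\<close>, \<open>I\<close> produces \<open>R\<close>, the
  choice of \<open>a\<close> produces \<open>X a\<close> and the removal of \<open>a\<close>
  contacts from \<open>J\<close>, and each remaining contact of \<open>J\<close> carries one
  \<open>q\<close>.\<close>

lemma interval_gf_Suc:
  assumes X: "\<And>a. B < a \<Longrightarrow> X a = 0" and Y: "\<And>b. B < b \<Longrightarrow> Y b = 0"
  shows "interval_gf m X Y q (Suc j) k = step_op B (fps_const q)
    (\<lambda>p. \<Sum>b\<le>B. fps_const (Y b) * interval_gf m X Y q 0 b p) (\<lambda>a. fps_const (X a)) (interval_gf m X Y q j k)"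
proof (rule ext, rule fps_ext)
  fix i n
  let ?c = "lower_contacts m" and ?w = "weight m X Y q" and ?S = "interval_set m"
  \<comment> \<open>\<open>rr\<close> and \<open>ss\<close> are the coefficients in \<open>t\<close>
    of the two factors of a summand of \<open>step_op\<close>.\<close>
  define rr where "rr p n' = (\<Sum>I\<in>?S 0 n'. if ?c 0 I = p then Y (upper_rise I) * ?w 0 I else 0)" for p n'
  define ss where "ss d n' = (\<Sum>J\<in>?S j n'. \<Sum>a\<le>?c j J.
     if ?c j J - a = d \<and> upper_rise J = k then q ^ d * (X a * ?w j J) else 0)" for d n'
  have R: "(\<Sum>b\<le>B. fps_const (Y b) * interval_gf m X Y q 0 b p) $ n' = rr p n'" for p n'
  proof -
    have "(\<Sum>b\<le>B. fps_const (Y b) * interval_gf m X Y q 0 b p) $ n' =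
       (\<Sum>b\<le>B. \<Sum>I\<in>?S 0 n'. if b = upper_rise I then (if ?c 0 I = p then Y b * ?w 0 I else 0) else 0)"
      by (auto simp: fps_sum_nth interval_gf_def sum_distrib_left intro!: sum.cong)
    also have "\<dots> = (\<Sum>I\<in>?S 0 n'. \<Sum>b\<le>B. if b = upper_rise I then (if ?c 0 I = p then Y b * ?w 0 I else 0) else 0)"
      by (rule sum.swap)
    also have "\<dots> = rr p n'"
      unfolding rr_def by (rule sum.cong) (auto simp: Y)
    finally show ?thesis .
  qed
  have S: "(fps_const q ^ d * (\<Sum>a\<le>B. fps_const (X a) * interval_gf m X Y q j k (d + a))) $ n' = ss d n'" for d n'
  proof -
    have "(fps_const q ^ d * (\<Sum>a\<le>B. fps_const (X a) * interval_gf m X Y q j k (d + a))) $ n' =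
       (\<Sum>a\<le>B. \<Sum>J\<in>?S j n'. if ?c j J = d + a \<and> upper_rise J = k then q ^ d * (X a * ?w j J) else 0)"
      by (auto simp: fps_const_power fps_sum_nth interval_gf_def sum_distrib_left intro!: sum.cong)
    also have "\<dots> = (\<Sum>J\<in>?S j n'. \<Sum>a\<le>B. if ?c j J = d + a \<and> upper_rise J = k then q ^ d * (X a * ?w j J) else 0)"
      by (rule sum.swap)
    also have "\<dots> = ss d n'"
      unfolding ss_def
    proof (rule sum.cong[OF refl])
      fix J
      \<comment> \<open>Terms with \<open>a > B\<close> vanish through \<open>X a\<close>; those
        with \<open>a\<close> beyond the number of contacts fail the condition.\<close>
      show "(\<Sum>a\<le>B. if ?c j J = d + a \<and> upper_rise J = k then q ^ d * (X a * ?w j J) else 0) =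
        (\<Sum>a\<le>?c j J. if ?c j J - a = d \<and> upper_rise J = k then q ^ d * (X a * ?w j J) else 0)"
        by (rule sum.mono_neutral_cong) (auto simp: X not_le)
    qed
    finally show ?thesis .
  qed
  define F where "F I J a = (if ?c 0 I + (?c j J - a) = i \<and> upper_rise J = k
     then (Y (upper_rise I) * ?w 0 I) * (q ^ (?c j J - a) * (X a * ?w j J)) else 0)" for I J a
  have "step_op B (fps_const q)
    (\<lambda>p. \<Sum>b\<le>B. fps_const (Y b) * interval_gf m X Y q 0 b p) (\<lambda>a. fps_const (X a)) (interval_gf m X Y q j k) i $ n
    = (\<Sum>p\<le>i. \<Sum>n'=0..n. rr p n' * ss (i - p) (n - n'))"
    unfolding step_op_def fps_sum_nth[of _ "{..i}"] mult.assoc fps_mult_nth[of "sum _ _"] R S ..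
  also have "\<dots> = (\<Sum>n'\<le>n. \<Sum>p\<le>i. rr p n' * ss (i - p) (n - n'))"
    by (subst sum.swap) (simp add: atLeast0AtMost)
  also have "\<dots> = (\<Sum>n'\<le>n. \<Sum>I\<in>?S 0 n'. \<Sum>J\<in>?S j (n - n'). \<Sum>a\<le>?c j J. F I J a)"
  proof (rule sum.cong[OF refl])
    fix n'
    have "(\<Sum>p\<le>i. rr p n' * ss (i - p) (n - n')) = (\<Sum>p\<le>i. \<Sum>I\<in>?S 0 n'.
        if p = ?c 0 I then Y (upper_rise I) * ?w 0 I * ss (i - p) (n - n') else 0)"
      unfolding rr_def sum_distrib_right by (auto intro!: sum.cong)
    also have "\<dots> = (\<Sum>I\<in>?S 0 n'. \<Sum>p\<le>i.
        if p = ?c 0 I then Y (upper_rise I) * ?w 0 I * ss (i - p) (n - n') else 0)"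
      by (rule sum.swap)
    also have "\<dots> = (\<Sum>I\<in>?S 0 n'. if ?c 0 I \<le> i then Y (upper_rise I) * ?w 0 I * ss (i - ?c 0 I) (n - n') else 0)"
      by (rule sum.cong) auto
    also have "\<dots> = (\<Sum>I\<in>?S 0 n'. \<Sum>J\<in>?S j (n - n'). \<Sum>a\<le>?c j J. F I J a)"
    proof (rule sum.cong[OF refl])
      fix I
      show "(if ?c 0 I \<le> i then Y (upper_rise I) * ?w 0 I * ss (i - ?c 0 I) (n - n') else 0) =
        (\<Sum>J\<in>?S j (n - n'). \<Sum>a\<le>?c j J. F I J a)"
      proof (cases "?c 0 I \<le> i")
        case True
        then have e: "?c 0 I + d = i \<longleftrightarrow> d = i - ?c 0 I" for d by auto
        show ?thesis unfolding F_def ss_def sum_distrib_left e using True by (auto intro!: sum.cong)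
      next
        case False
        then have "?c 0 I + d = i \<longleftrightarrow> False" for d by auto
        then show ?thesis using False by (simp only: F_def simp_thms if_False sum.neutral_const)
      qed
    qed
    finally show "(\<Sum>p\<le>i. rr p n' * ss (i - p) (n - n')) = \<dots>" .
  qed
  also have "\<dots> = (\<Sum>(n', I, J, a)\<in>glue_domain m j n. F I J a)"
    unfolding glue_domain_def by (simp add: sum.Sigma)
  also have "\<dots> = (\<Sum>x\<in>glue_domain m j n. if ?c (Suc j) (glue m j x) = i \<and> upper_rise (glue m j x) = k
      then ?w (Suc j) (glue m j x) else 0)"
  proof (rule sum.cong[OF refl], clarify)
    fix n' P Q d P' Q' d' a
    assume "(n', (P, Q, d), (P', Q', d'), a) \<in> glue_domain m j n"
    then have *: "(P, Q, d) \<in> ?S 0 n'" "(P', Q', d') \<in> ?S j (n - n')" "a \<le> ?c j (P', Q', d')"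
      by (auto simp: glue_domain_def)
    show "F (P, Q, d) (P', Q', d') a =
       (if ?c (Suc j) (glue m j (n', (P, Q, d), (P', Q', d'), a)) = i \<and>
           upper_rise (glue m j (n', (P, Q, d), (P', Q', d'), a)) = k
        then ?w (Suc j) (glue m j (n', (P, Q, d), (P', Q', d'), a)) else 0)"
      unfolding glue_stats[OF *] F_def ..
  qed
  also have "\<dots> = interval_gf m X Y q (Suc j) k i $ n"
    unfolding interval_gf_def fps_nth_Abs_fps
    by (rule sum.reindex_bij_betw[OF bij_betw_glue])
  finally show "interval_gf m X Y q (Suc j) k i $ n = step_op B (fps_const q)
    (\<lambda>p. \<Sum>b\<le>B. fps_const (Y b) * interval_gf m X Y q 0 b p) (\<lambda>a. fps_const (X a)) (interval_gf m X Y q j k) i $ n"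
    ..
qed

text \<open>The \<open>j\<close>-th power of the operator leads to starting height \<open>j\<close>;
  at \<open>j = m\<close> the recursion closes, since a vertical step leads from the base line to
  height \<open>m\<close>.\<close>

lemma interval_gf_operator_system:
  assumes "\<And>a. B < a \<Longrightarrow> X a = 0" "\<And>b. B < b \<Longrightarrow> Y b = 0"
  shows "operator_system m B fps_X (fps_const q) (\<lambda>a. fps_const (X a)) (\<lambda>b. fps_const (Y b))
    (\<lambda>p. \<Sum>b\<le>B. fps_const (Y b) * interval_gf m X Y q 0 b p) (interval_gf m X Y q 0)"
proof -
  have "(step_op B (fps_const q) (\<lambda>p. \<Sum>b\<le>B. fps_const (Y b) * interval_gf m X Y q 0 b p)
      (\<lambda>a. fps_const (X a)) ^^ j) (interval_gf m X Y q 0 k) = interval_gf m X Y q j k" for j k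
    by (induction j) (simp_all add: interval_gf_Suc[OF assms])
  then show ?thesis
    unfolding operator_system_def by (simp add: interval_gf_0_0 interval_gf_0_Suc)
qed

lemma interval_gf_symmetric:
  assumes "\<And>a. B < a \<Longrightarrow> X a = 0" "\<And>b. B < b \<Longrightarrow> Y b = 0"
  shows "interval_gf m X Y q 0 k i = interval_gf m Y X q 0 i k"
  using operator_system_symmetric[OF interval_gf_operator_system[OF assms]
    interval_gf_operator_system[OF assms(2,1)]] .

section \<open>Rise-contact symmetry\<close>

lemma base_contacts_le: "base_contacts m h w \<le> count_list w Vert"
  by (induction m h w rule: base_contacts.induct) auto

lemma vert_contacts_le: "c \<in> set (vert_contacts m w) \<Longrightarrow> c \<le> count_list w Vert"
  by (induction m w rule: vert_contacts.induct)
    (auto simp del: upt_Suc intro: le_SucI[OF base_contacts_le] le_SucI)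

lemma runs_le: "r \<in> set (runs w) \<Longrightarrow> r \<le> count_list w Vert"
proof (induction w arbitrary: r rule: runs.induct)
  case (3 w)
  have "r \<in> set (runs w) \<or> r = Suc (hd (runs w))"
    using "3.prems" by (auto dest: list.set_sel(2)[rotated])
  then show ?case using "3.IH"(1)[of r] "3.IH"(1)[of "hd (runs w)"] by auto
qed auto

text \<open>All labels of an interval of size \<open>n\<close> are at most \<open>n\<close>, so
  truncation keeps its weight and supplies the bound for \<open>step_op\<close>.\<close>

definition truncate_at :: "nat \<Rightarrow> (nat \<Rightarrow> 'a::zero) \<Rightarrow> nat \<Rightarrow> 'a" where
  "truncate_at n X a = (if a \<le> n then X a else 0)"

lemma weight_truncate:
  assumes "I \<in> interval_set m 0 n"
  shows "weight m (truncate_at n X) (truncate_at n Y) q 0 I = weight m X Y q 0 I"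
proof -
  obtain P Q d where I: "I = (P, Q, d)" by (cases I) auto
  have c: "count_list P Vert = n" "count_list Q Vert = n"
    using assms interval_descent_path[of m 0 P Q d] by (auto simp: I interval_set_def)
  have "map (truncate_at n X) (vert_contacts m P) = map X (vert_contacts m P)"
    using vert_contacts_le[of _ m P] c by (auto simp: truncate_at_def)
  moreover have "map (truncate_at n Y) (tl (runs Q)) = map Y (tl (runs Q))"
    using runs_le[of _ Q] c by (auto simp: truncate_at_def dest: list.set_sel(2)[rotated])
  ultimately show ?thesis by (simp add: I weight_def contact_labels_def del: map_eq_conv)
qed

lemma interval_sum_eq_gf:
  "(\<Sum>I\<in>interval_set m 0 n. x ^ lower_contacts m 0 I * y ^ upper_rise I *
      (X (lower_contacts m 0 I) * Y (upper_rise I) * weight m X Y q 0 I)) =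
   (\<Sum>i\<le>n. \<Sum>k\<le>n. x ^ i * y ^ k * (X i * Y k *
      interval_gf m (truncate_at n X) (truncate_at n Y) q 0 k i $ n))" (is "?L = ?R")
proof -
  let ?S = "interval_set m 0 n" and ?c = "lower_contacts m 0"
  define T where "T I i k = x ^ i * y ^ k * (X i * Y k * weight m X Y q 0 I)" for I i k
  have "?R = (\<Sum>i\<le>n. \<Sum>k\<le>n. \<Sum>I\<in>?S. if ?c I = i \<and> upper_rise I = k then T I i k else 0)"
    unfolding interval_gf_def fps_nth_Abs_fps sum_distrib_left
    by (intro sum.cong refl) (auto simp: weight_truncate T_def)
  also have "\<dots> = (\<Sum>i\<le>n. \<Sum>I\<in>?S. \<Sum>k\<le>n. if ?c I = i \<and> upper_rise I = k then T I i k else 0)"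
    by (rule sum.cong[OF refl], rule sum.swap)
  also have "\<dots> = (\<Sum>I\<in>?S. \<Sum>i\<le>n. \<Sum>k\<le>n. if ?c I = i \<and> upper_rise I = k then T I i k else 0)"
    by (rule sum.swap)
  also have "\<dots> = (\<Sum>I\<in>?S. T I (?c I) (upper_rise I))"
  proof (rule sum.cong[OF refl])
    fix I assume I: "I \<in> ?S"
    then have c: "count_list (fst I) Vert = n" "count_list (fst (snd I)) Vert = n"
      by (auto simp: interval_set_def dest: interval_descent_path)
    have le: "?c I \<le> n" "upper_rise I \<le> n"
      using base_contacts_le[of m 0 "fst I"] runs_le[of "upper_rise I" "fst (snd I)"] c by auto
    have "(\<Sum>i\<le>n. \<Sum>k\<le>n. if ?c I = i \<and> upper_rise I = k then T I i k else 0) =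
       (\<Sum>i\<le>n. if ?c I = i then (\<Sum>k\<le>n. if upper_rise I = k then T I i k else 0) else 0)"
      by (intro sum.cong refl) auto
    also have "\<dots> = T I (?c I) (upper_rise I)"
      using le by simp
    finally show "(\<Sum>i\<le>n. \<Sum>k\<le>n. if ?c I = i \<and> upper_rise I = k then T I i k else 0) =
        T I (?c I) (upper_rise I)" .
  qed
  finally show ?thesis by (simp add: T_def)
qed

lemma interval_sum_symmetric:
  "(\<Sum>I\<in>interval_set m 0 n. x ^ lower_contacts m 0 I * y ^ upper_rise I *
      (X (lower_contacts m 0 I) * Y (upper_rise I) * weight m X Y q 0 I)) =
   (\<Sum>I\<in>interval_set m 0 n. y ^ lower_contacts m 0 I * x ^ upper_rise I *
      (Y (lower_contacts m 0 I) * X (upper_rise I) * weight m Y X q 0 I))"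
proof -
  have "interval_gf m (truncate_at n X) (truncate_at n Y) q 0 k i =
      interval_gf m (truncate_at n Y) (truncate_at n X) q 0 i k" for i k
    by (rule interval_gf_symmetric[of n]) (simp_all add: truncate_at_def)
  then show ?thesis
    unfolding interval_sum_eq_gf by (subst sum.swap) (simp add: ac_simps)
qed

text \<open>The factors \<open>X 0\<close> and \<open>Y 0\<close> restore the zero entries dropped
  by \<open>butlast\<close>. Since the paths determine \<open>d\<close>, triples correspond to
  Tamari intervals.\<close>

lemma Phi_nth_eq_interval_sum:
  fixes X Y :: "nat \<Rightarrow> 'a::comm_ring_1"
  assumes "1 \<le> m"
  shows "X 0 * (Y 0 * Phi m x y X Y q $ n) =
    (\<Sum>I\<in>interval_set m 0 n. x ^ lower_contacts m 0 I * y ^ upper_rise I *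
      (X (lower_contacts m 0 I) * Y (upper_rise I) * weight m X Y q 0 I))"
proof -
  let ?f = "\<lambda>(P, Q, d :: nat). (P, Q)"
  have "inj_on ?f (interval_set m 0 n)"
    by (auto simp: inj_on_def interval_set_def dest: interval_dist_unique)
  moreover have "?f ` interval_set m 0 n = tamari_intervals m n"
    by (auto simp: interval_set_def tamari_intervals_def tamari_le_iff image_iff)
  ultimately have b: "bij_betw ?f (interval_set m 0 n) (tamari_intervals m n)"
    by (rule bij_betw_imageI)
  show ?thesis
    unfolding Phi_def fps_nth_Abs_fps sum.reindex_bij_betw[OF b, symmetric] sum_distrib_left
  proof (rule sum.cong[OF refl])
    fix J assume J: "J \<in> interval_set m 0 n"
    obtain P Q d where PQ: "J = (P, Q, d)" by (cases J) auto
    have I: "interval m 0 P Q d" "count_list Q Vert = n" using J by (auto simp: PQ interval_set_def)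
    have P: "descent_path m 0 P" and Q: "descent_path m 0 Q" using interval_descent_path[OF I(1)] by auto
    have "X 0 * (Y 0 * (x ^ mcontacts m P * y ^ mrises Q * mContactMon m P X * mRiseMon Q Y * q ^ d)) =
      x ^ mcontacts m P * y ^ mrises Q * ((mContactMon m P X * X 0) * (mRiseMon Q Y * Y 0) * q ^ d)"
      by (simp add: ac_simps)
    also have "\<dots> = x ^ base_contacts m 0 P * y ^ hd (runs Q) *
       (X (base_contacts m 0 P) * Y (hd (runs Q)) * weight m X Y q 0 (P, Q, d))"
      unfolding mContactMon_eq[OF assms P] mRiseMon_eq[OF assms Q] mcontacts_eq[OF P] mrises_eq
      by (simp add: weight_def contact_labels_def ac_simps)
    finally show "X 0 * (Y 0 * (x ^ mcontacts m (fst (?f J)) * y ^ mrises (snd (?f J)) *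
        mContactMon m (fst (?f J)) X * mRiseMon (snd (?f J)) Y * q ^ tamari_dist m n (?f J))) =
      x ^ lower_contacts m 0 J * y ^ upper_rise J *
       (X (lower_contacts m 0 J) * Y (upper_rise J) * weight m X Y q 0 J)"
      by (simp add: PQ tamari_dist_eq[OF I])
  qed
qed

section \<open>Cancelling variables and conclusion\<close>

lemma lookup_single_mult:
  fixes p :: "('a::cancel_comm_monoid_add) \<Rightarrow>\<^sub>0 ('b::comm_semiring_1)"
  shows "Poly_Mapping.lookup (Poly_Mapping.single k 1 * p) (k + l) = Poly_Mapping.lookup p l"
proof -
  have "Poly_Mapping.lookup (Poly_Mapping.single k 1 * p) (k + l) =
      (\<Sum>l'. (\<Sum>r. Poly_Mapping.lookup p r when k + l = l' + r) when l' = k)"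
    unfolding lookup_mult lookup_single
    by (rule Sum_any.cong) (auto simp: when_def)
  then show ?thesis by (simp add: when_def)
qed

text \<open>Multiplication by a variable translates the exponents, so all coefficients can be read
  off the product.\<close>

lemma Var_mult_cancel: "Var v * p = Var v * r \<Longrightarrow> p = r"
  unfolding Var_def by (rule poly_mapping_eqI) (metis lookup_single_mult)

theorem theorem5p5:
  fixes m :: nat
  assumes "m \<ge> 1"
  shows "Phi m (Var Ind_x) (Var Ind_y) (\<lambda>i. Var (Ind_X i)) (\<lambda>i. Var (Ind_Y i)) (Var Ind_q)
       = Phi m (Var Ind_y) (Var Ind_x) (\<lambda>i. Var (Ind_Y i)) (\<lambda>i. Var (Ind_X i)) (Var Ind_q)"
proof (rule fps_ext)
  fix n
  let ?X = "\<lambda>i. Var (Ind_X i)" and ?Y = "\<lambda>i. Var (Ind_Y i)"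
  note Phi_nth_eq_interval_sum[OF assms, of ?X ?Y "Var Ind_x" "Var Ind_y" "Var Ind_q" n]
  also note interval_sum_symmetric
  also note Phi_nth_eq_interval_sum[OF assms, of ?Y ?X "Var Ind_y" "Var Ind_x" "Var Ind_q" n, symmetric]
  \<comment> \<open>After the exchange of alphabets the two prefactors stand in the opposite
    order.\<close>
  also note mult.left_commute
  finally have "?X 0 * (?Y 0 * Phi m (Var Ind_x) (Var Ind_y) ?X ?Y (Var Ind_q) $ n) =
      ?X 0 * (?Y 0 * Phi m (Var Ind_y) (Var Ind_x) ?Y ?X (Var Ind_q) $ n)" .
  then show "Phi m (Var Ind_x) (Var Ind_y) ?X ?Y (Var Ind_q) $ n =
      Phi m (Var Ind_y) (Var Ind_x) ?Y ?X (Var Ind_q) $ n"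
    by (rule Var_mult_cancel[OF Var_mult_cancel])
qed

end
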